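(* Let $(X,T)$ be a topological dynamical system and let $\mathbf A\subset X\times X$ be the set of its asymptotic pairs. The closure $\overline{\mathbf A}$ of $\mathbf A$ in $X\times X$ contains the set $E(X,T)$ of entropy pairs of $(X,T)$.
   Context: A topological dynamical system $(X,T)$ is a compact metric space $X$ with distance $d$ together with a homeomorphism $T:X\to X$. A pair $(x,y)$ is asymptotic if $\lim_{n\to+\infty}d(T^nx,T^ny)=0$. A pair $(x,y)\in X\times X$ with $x\ne y$ is an entropy pair of $(X,T)$ if for every open cover $\{U,V\}$ of $X$ by two non-dense open sets such that $x$ is in the interior of $X\setminus U$ and $y$ is in the interior of $X\setminus V$, the topological entropy $h(\{U,V\},T)$ of the cover is positive. $E(X,T)$ denotes the set of entropy pairs. *)

theory Defs
  imports "HOL-Analysis.Analysis"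
begin

text \<open>
  The phase space is a compact subset X of an ambient metric space. All topological notions
  are taken relative to X. The map T is only constrained on X.
\<close>

definition topological_dynamical_system :: "'a::metric_space set \<Rightarrow> ('a \<Rightarrow> 'a) \<Rightarrow> bool" where
  "topological_dynamical_system X T \<longleftrightarrow> compact X \<and> (\<exists>S. homeomorphism X X T S)"

definition asymptotic_pairs :: "'a::metric_space set \<Rightarrow> ('a \<Rightarrow> 'a) \<Rightarrow> ('a \<times> 'a) set" where
  "asymptotic_pairs X T =
    {(x, y). x \<in> X \<and> y \<in> X \<and> (\<lambda>n. dist ((T ^^ n) x) ((T ^^ n) y)) \<longlonglongrightarrow> 0}"

definition open_cover :: "'a::metric_space set \<Rightarrow> 'a set set \<Rightarrow> bool" where
  "open_cover X C \<longleftrightarrow> (\<forall>U\<in>C. openin (top_of_set X) U) \<and> \<Union>C = X"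

definition cover_join :: "'a set set \<Rightarrow> 'a set set \<Rightarrow> 'a set set" where
  "cover_join C D = {U \<inter> V | U V. U \<in> C \<and> V \<in> D}"

definition cover_preimage :: "'a set \<Rightarrow> ('a \<Rightarrow> 'a) \<Rightarrow> 'a set set \<Rightarrow> 'a set set" where
  "cover_preimage X f C = {X \<inter> f -` U | U. U \<in> C}"

text \<open>
  The join of the preimages of C under the iterates of T with exponents 0, ..., n - 1.
  The empty join is the trivial cover.
\<close>

primrec iterated_join :: "'a set \<Rightarrow> ('a \<Rightarrow> 'a) \<Rightarrow> 'a set set \<Rightarrow> nat \<Rightarrow> 'a set set" where
  "iterated_join X T C 0 = {X}"
| "iterated_join X T C (Suc n) =
    cover_join (iterated_join X T C n) (cover_preimage X (T ^^ n) C)"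

definition min_subcover_card :: "'a set \<Rightarrow> 'a set set \<Rightarrow> nat" where
  "min_subcover_card X C = (LEAST k. \<exists>D\<subseteq>C. finite D \<and> \<Union>D = X \<and> card D = k)"

text \<open>
  The limit exists for every open cover of a topological dynamical system, by subadditivity
  of the sequence of logarithms. The term for n = 0 is 0 and is irrelevant.
\<close>

definition cover_entropy :: "'a set \<Rightarrow> ('a \<Rightarrow> 'a) \<Rightarrow> 'a set set \<Rightarrow> real" where
  "cover_entropy X T C =
    lim (\<lambda>n. ln (real (min_subcover_card X (iterated_join X T C n))) / real n)"

definition entropy_pairs :: "'a::metric_space set \<Rightarrow> ('a \<Rightarrow> 'a) \<Rightarrow> ('a \<times> 'a) set" where
  "entropy_pairs X T =
    {(x, y). x \<in> X \<and> y \<in> X \<and> x \<noteq> y \<and>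
      (\<forall>U V. open_cover X {U, V} \<and>
             (top_of_set X) closure_of U \<noteq> X \<and> (top_of_set X) closure_of V \<noteq> X \<and>
             x \<in> (top_of_set X) interior_of (X - U) \<and>
             y \<in> (top_of_set X) interior_of (X - V)
         \<longrightarrow> cover_entropy X T {U, V} > 0)}"

end

theory Submission imports Defs "HOL-Complex_Analysis.Great_Picard" begin

text \<open>
  Let A and B be disjoint closed neighbourhoods of the two points of an entropy pair. Since the
  cover by their complements has positive entropy, a Sauer-Shelah argument yields, for infinitely
  many n, a set of times J below n of positive density such that every itinerary in A and B along
  J is realised by some orbit. Choosing the itinerary uniformly at random, Shannon entropies of the
  itinerary and of finite codings of the orbit at finer and finer scales, averaged over the n time
  shifts and passed to a limit in n, give a shift-invariant submodular set function E. Under E the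
  present letter has positive entropy given all future letters. As in Pinsker's formula for the
  entropy rate, the codings can be added one scale after another to the condition, each from a
  sufficiently late time on, each costing at most half of what is left. Hence there are points
  of A and B whose orbits have the same codes at the first K scales, from the chosen times up to a
  horizon K; a limit point as K grows is an asymptotic pair.
\<close>

section \<open>Shannon entropy on finite uniform spaces\<close>

text \<open>The atom through \<omega> of the partition of \<Omega> generated by the variables
  \<open>Y s\<close>, \<open>s \<in> S\<close>.\<close>

definition fib :: "'w set \<Rightarrow> ('s \<Rightarrow> 'w \<Rightarrow> 'v) \<Rightarrow> 's set \<Rightarrow> 'w \<Rightarrow> 'w set" where
  "fib \<Omega> Y S \<omega> = {\<omega>' \<in> \<Omega>. \<forall>s\<in>S. Y s \<omega>' = Y s \<omega>}"

text \<open>Joint Shannon entropy, in nats, of the variables indexed by \<open>S\<close> under the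
  uniform law on \<Omega>. It is written as the mean of the information function over points rather
  than as a sum over values.\<close>

definition ent :: "'w set \<Rightarrow> ('s \<Rightarrow> 'w \<Rightarrow> 'v) \<Rightarrow> 's set \<Rightarrow> real" where
  "ent \<Omega> Y S = (\<Sum>\<omega>\<in>\<Omega>. ln (card \<Omega> / card (fib \<Omega> Y S \<omega>))) / card \<Omega>"

lemma finite_fib [simp]: "finite \<Omega> \<Longrightarrow> finite (fib \<Omega> Y S \<omega>)"
  by (simp add: fib_def)

lemma fib_subset: "fib \<Omega> Y S \<omega> \<subseteq> \<Omega>"
  by (auto simp: fib_def)

lemma card_fib_pos: "finite \<Omega> \<Longrightarrow> \<omega> \<in> \<Omega> \<Longrightarrow> card (fib \<Omega> Y S \<omega>) > 0"
  by (auto simp: card_gt_0_iff fib_def)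

lemma fib_antimono: "S \<subseteq> S' \<Longrightarrow> fib \<Omega> Y S' \<omega> \<subseteq> fib \<Omega> Y S \<omega>"
  by (auto simp: fib_def)

lemma ent_mono:
  assumes fin: "finite \<Omega>" and sub: "S \<subseteq> S'"
  shows "ent \<Omega> Y S \<le> ent \<Omega> Y S'"
  unfolding ent_def
proof (intro divide_right_mono sum_mono)
  fix \<omega> assume w: "\<omega> \<in> \<Omega>"
  have "card (fib \<Omega> Y S' \<omega>) \<le> card (fib \<Omega> Y S \<omega>)"
    using fin sub by (intro card_mono fib_antimono) auto
  moreover have "card (fib \<Omega> Y S' \<omega>) > 0" "card (fib \<Omega> Y S \<omega>) > 0"
    using fin w by (simp_all only: card_fib_pos)
  moreover have "card \<Omega> > 0"
    using fin w by (auto simp: card_gt_0_iff)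
  ultimately show "ln (card \<Omega> / card (fib \<Omega> Y S \<omega>)) \<le> ln (card \<Omega> / card (fib \<Omega> Y S' \<omega>))"
    by (simp add: frac_le)
qed simp

lemma ent_nonneg:
  assumes "finite \<Omega>" shows "0 \<le> ent \<Omega> Y S"
  unfolding ent_def
proof (intro divide_nonneg_nonneg sum_nonneg)
  fix \<omega> assume w: "\<omega> \<in> \<Omega>"
  have "card (fib \<Omega> Y S \<omega>) \<le> card \<Omega>"
    using assms by (intro card_mono fib_subset)
  then show "0 \<le> ln (card \<Omega> / card (fib \<Omega> Y S \<omega>))"
    using card_fib_pos[OF assms w, of Y S] by simp
qed simp

lemma fib_eq: "\<omega>' \<in> fib \<Omega> Y S \<omega> \<Longrightarrow> fib \<Omega> Y S \<omega>' = fib \<Omega> Y S \<omega>"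
  by (auto simp: fib_def)

text \<open>The numerator counts pairs (\<alpha>, \<beta>) such that \<omega> lies in the
  \<open>S\<close>-atom of \<alpha> and the \<open>T\<close>-atom of \<beta>. After exchanging sums,
  a pair contributes at most \<open>1 / n (S \<inter> T) \<alpha>\<close>, and only if \<beta> lies
  in the \<open>S \<inter> T\<close>-atom of \<alpha>; summing over \<beta> leaves 1 for each
  \<alpha>.\<close>

lemma fib_sum_le:
  fixes \<Omega> :: "'w set" and Y :: "'s \<Rightarrow> 'w \<Rightarrow> 'v"
  assumes fin: "finite \<Omega>"
  defines "n \<equiv> \<lambda>S \<omega>. real (card (fib \<Omega> Y S \<omega>))"
  shows "(\<Sum>\<omega>\<in>\<Omega>. n S \<omega> * n T \<omega> / (n (S \<union> T) \<omega> * n (S \<inter> T) \<omega>)) \<le> card \<Omega>"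
proof -
  let ?g = "\<lambda>\<omega>. 1 / (n (S \<union> T) \<omega> * n (S \<inter> T) \<omega>)"
  have n_sum: "n U \<omega> = (\<Sum>\<alpha>\<in>\<Omega>. if \<omega> \<in> fib \<Omega> Y U \<alpha> then 1 else 0)" if "\<omega> \<in> \<Omega>" for U \<omega>
  proof -
    have "fib \<Omega> Y U \<omega> = {\<alpha>\<in>\<Omega>. \<omega> \<in> fib \<Omega> Y U \<alpha>}"
      using that by (auto simp: fib_def)
    then show ?thesis
      using fin by (simp add: n_def flip: sum.inter_filter)
  qed
  have "(\<Sum>\<omega>\<in>\<Omega>. n S \<omega> * n T \<omega> / (n (S \<union> T) \<omega> * n (S \<inter> T) \<omega>))
      = (\<Sum>\<omega>\<in>\<Omega>. \<Sum>\<alpha>\<in>\<Omega>. \<Sum>\<beta>\<in>\<Omega>. if \<omega> \<in> fib \<Omega> Y S \<alpha> \<and> \<omega> \<in> fib \<Omega> Y T \<beta> then ?g \<omega> else 0)"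
  proof (rule sum.cong[OF refl])
    fix \<omega> assume w: "\<omega> \<in> \<Omega>"
    have "n S \<omega> * n T \<omega> = (\<Sum>\<alpha>\<in>\<Omega>. \<Sum>\<beta>\<in>\<Omega>.
      (if \<omega> \<in> fib \<Omega> Y S \<alpha> then 1 else 0) * (if \<omega> \<in> fib \<Omega> Y T \<beta> then 1 else 0))"
      by (simp only: n_sum[OF w] sum_product)
    then have "n S \<omega> * n T \<omega> * ?g \<omega> = (\<Sum>\<alpha>\<in>\<Omega>. \<Sum>\<beta>\<in>\<Omega>.
      (if \<omega> \<in> fib \<Omega> Y S \<alpha> then 1 else 0) * (if \<omega> \<in> fib \<Omega> Y T \<beta> then 1 else 0) * ?g \<omega>)"
      by (simp only: sum_distrib_right)
    also have "\<dots> = (\<Sum>\<alpha>\<in>\<Omega>. \<Sum>\<beta>\<in>\<Omega>. if \<omega> \<in> fib \<Omega> Y S \<alpha> \<and> \<omega> \<in> fib \<Omega> Y T \<beta> then ?g \<omega> else 0)"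
      by (intro sum.cong) auto
    finally show "n S \<omega> * n T \<omega> / (n (S \<union> T) \<omega> * n (S \<inter> T) \<omega>)
      = (\<Sum>\<alpha>\<in>\<Omega>. \<Sum>\<beta>\<in>\<Omega>. if \<omega> \<in> fib \<Omega> Y S \<alpha> \<and> \<omega> \<in> fib \<Omega> Y T \<beta> then ?g \<omega> else 0)" by simp
  qed
  also have "\<dots> = (\<Sum>\<alpha>\<in>\<Omega>. \<Sum>\<omega>\<in>\<Omega>. \<Sum>\<beta>\<in>\<Omega>. if \<omega> \<in> fib \<Omega> Y S \<alpha> \<and> \<omega> \<in> fib \<Omega> Y T \<beta> then ?g \<omega> else 0)"
    by (rule sum.swap)
  also have "\<dots> = (\<Sum>\<alpha>\<in>\<Omega>. \<Sum>\<beta>\<in>\<Omega>. \<Sum>\<omega>\<in>\<Omega>. if \<omega> \<in> fib \<Omega> Y S \<alpha> \<and> \<omega> \<in> fib \<Omega> Y T \<beta> then ?g \<omega> else 0)"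
    by (rule sum.cong[OF refl], rule sum.swap)
  also have "\<dots> \<le> (\<Sum>\<alpha>\<in>\<Omega>. \<Sum>\<beta>\<in>\<Omega>. if \<beta> \<in> fib \<Omega> Y (S \<inter> T) \<alpha> then 1 / n (S \<inter> T) \<alpha> else 0)"
  proof (intro sum_mono)
    fix \<alpha> \<beta> assume ab: "\<alpha> \<in> \<Omega>" "\<beta> \<in> \<Omega>"
    let ?C = "{\<omega>\<in>\<Omega>. \<omega> \<in> fib \<Omega> Y S \<alpha> \<and> \<omega> \<in> fib \<Omega> Y T \<beta>}"
    have eq: "(\<Sum>\<omega>\<in>\<Omega>. if \<omega> \<in> fib \<Omega> Y S \<alpha> \<and> \<omega> \<in> fib \<Omega> Y T \<beta> then ?g \<omega> else 0) = sum ?g ?C"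
      using fin by (rule sum.inter_filter[symmetric])
    show "(\<Sum>\<omega>\<in>\<Omega>. if \<omega> \<in> fib \<Omega> Y S \<alpha> \<and> \<omega> \<in> fib \<Omega> Y T \<beta> then ?g \<omega> else 0)
       \<le> (if \<beta> \<in> fib \<Omega> Y (S \<inter> T) \<alpha> then 1 / n (S \<inter> T) \<alpha> else 0)"
    proof (cases "?C = {}")
      case True
      show ?thesis unfolding eq unfolding True by (simp add: n_def)
    next
      case False
      then obtain \<gamma> where c: "\<gamma> \<in> \<Omega>" "\<gamma> \<in> fib \<Omega> Y S \<alpha>" "\<gamma> \<in> fib \<Omega> Y T \<beta>" by auto
      \<comment> \<open>Values prescribed on \<open>S\<close> by \<alpha> and on \<open>T\<close> by
        \<beta> are prescribed on \<open>S \<union> T\<close>, so the solutions form a single atom,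
        on which \<open>?g\<close> is constant.\<close>
      have C: "?C = fib \<Omega> Y (S \<union> T) \<gamma>" using c by (auto simp: fib_def)
      have gz: "\<gamma> \<in> fib \<Omega> Y (S \<inter> T) \<alpha>" using c by (auto simp: fib_def)
      have bz: "\<beta> \<in> fib \<Omega> Y (S \<inter> T) \<alpha>" using c ab by (auto simp: fib_def)
      have "sum ?g ?C = (\<Sum>\<omega>\<in>fib \<Omega> Y (S \<union> T) \<gamma>. 1 / (n (S \<union> T) \<gamma> * n (S \<inter> T) \<alpha>))"
        unfolding C
      proof (rule sum.cong[OF refl])
        fix \<omega> assume w: "\<omega> \<in> fib \<Omega> Y (S \<union> T) \<gamma>"
        then have "\<omega> \<in> fib \<Omega> Y (S \<inter> T) \<alpha>" using gz by (auto simp: fib_def)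
        then show "?g \<omega> = 1 / (n (S \<union> T) \<gamma> * n (S \<inter> T) \<alpha>)"
          using fib_eq[OF w] unfolding n_def by (simp add: fib_eq)
      qed
      also have "\<dots> = 1 / n (S \<inter> T) \<alpha>"
        using card_fib_pos[OF fin c(1), of Y "S \<union> T"] by (simp add: n_def)
      finally show ?thesis unfolding eq if_P[OF bz] by (rule eq_refl)
    qed
  qed
  also have "\<dots> = (\<Sum>\<alpha>\<in>\<Omega>. 1)"
  proof (rule sum.cong[OF refl])
    fix \<alpha> assume a: "\<alpha> \<in> \<Omega>"
    have "{\<beta>\<in>\<Omega>. \<beta> \<in> fib \<Omega> Y (S \<inter> T) \<alpha>} = fib \<Omega> Y (S \<inter> T) \<alpha>" by (auto simp: fib_def)
    then show "(\<Sum>\<beta>\<in>\<Omega>. if \<beta> \<in> fib \<Omega> Y (S \<inter> T) \<alpha> then 1 / n (S \<inter> T) \<alpha> else 0) = 1"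
      using fin card_fib_pos[OF fin a, of Y "S \<inter> T"]
      by (auto simp: n_def simp flip: sum.inter_filter)
  qed
  finally show ?thesis by simp
qed

text \<open>Nonnegativity of conditional mutual information: the difference is the mean of the
  logarithm of the ratio in \<open>fib_sum_le\<close>, and \<open>ln z \<le> z - 1\<close>.\<close>

lemma ent_submodular:
  fixes \<Omega> :: "'w set" and Y :: "'s \<Rightarrow> 'w \<Rightarrow> 'v"
  assumes fin: "finite \<Omega>"
  shows "ent \<Omega> Y (S \<union> T) + ent \<Omega> Y (S \<inter> T) \<le> ent \<Omega> Y S + ent \<Omega> Y T"
proof (cases "\<Omega> = {}")
  case True then show ?thesis by (simp add: ent_def)
next
  case False
  define n where "n = (\<lambda>S \<omega>. real (card (fib \<Omega> Y S \<omega>)))"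
  define N where "N = real (card \<Omega>)"
  have N: "N > 0" using False fin by (simp add: N_def card_gt_0_iff)
  have n: "n U \<omega> > 0" if "\<omega> \<in> \<Omega>" for U \<omega>
    using card_fib_pos[OF fin that, of Y U] by (simp add: n_def)
  have n0: "n U \<omega> \<noteq> 0" if "\<omega> \<in> \<Omega>" for U \<omega>
    using n[OF that, of U] by simp
  have entN: "N * ent \<Omega> Y U = (\<Sum>\<omega>\<in>\<Omega>. ln N - ln (n U \<omega>))" for U
  proof -
    have "N * ent \<Omega> Y U = (\<Sum>\<omega>\<in>\<Omega>. ln (N / n U \<omega>))"
      using N by (simp add: ent_def N_def n_def)
    also have "\<dots> = (\<Sum>\<omega>\<in>\<Omega>. ln N - ln (n U \<omega>))"
      using N n n0 by (intro sum.cong) (auto simp: ln_div)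
    finally show ?thesis .
  qed
  have "N * ent \<Omega> Y (S \<union> T) + N * ent \<Omega> Y (S \<inter> T) - (N * ent \<Omega> Y S + N * ent \<Omega> Y T)
     = (\<Sum>\<omega>\<in>\<Omega>. ln (n S \<omega> * n T \<omega> / (n (S \<union> T) \<omega> * n (S \<inter> T) \<omega>)))"
    unfolding entN sum.distrib[symmetric] sum_subtractf[symmetric]
    using n n0 by (intro sum.cong) (auto simp: ln_div ln_mult)
  also have "\<dots> \<le> (\<Sum>\<omega>\<in>\<Omega>. n S \<omega> * n T \<omega> / (n (S \<union> T) \<omega> * n (S \<inter> T) \<omega>) - 1)"
    using n by (intro sum_mono ln_le_minus_one) simp
  also have "\<dots> \<le> 0"
    using fib_sum_le[OF fin, of Y S T] by (simp add: sum_subtractf n_def)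
  finally have "N * (ent \<Omega> Y (S \<union> T) + ent \<Omega> Y (S \<inter> T)) \<le> N * (ent \<Omega> Y S + ent \<Omega> Y T)"
    by (simp add: algebra_simps)
  then show ?thesis using N by simp
qed

lemma ent_empty: "ent \<Omega> Y {} = 0"
  by (simp add: ent_def fib_def)

text \<open>After \<open>ln z \<le> z\<close>, each value of \<open>Y s\<close> contributes exactly
  \<open>card \<Omega>\<close> to the sum. The crude \<open>r\<close> in place of
  \<open>ln r\<close> serves only for boundedness.\<close>

lemma ent_singleton_le:
  assumes fin: "finite \<Omega>" and r: "card (Y s ` \<Omega>) \<le> r"
  shows "ent \<Omega> Y {s} \<le> r"
proof (cases "\<Omega> = {}")
  case True then show ?thesis by (simp add: ent_def)
next
  case False
  then have N: "card \<Omega> > 0" using fin by (simp add: card_gt_0_iff)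
  have "(\<Sum>\<omega>\<in>\<Omega>. ln (card \<Omega> / card (fib \<Omega> Y {s} \<omega>))) \<le> (\<Sum>\<omega>\<in>\<Omega>. card \<Omega> / card (fib \<Omega> Y {s} \<omega>))"
  proof (rule sum_mono)
    fix \<omega> assume "\<omega> \<in> \<Omega>"
    then have "real (card \<Omega>) / card (fib \<Omega> Y {s} \<omega>) > 0"
      using card_fib_pos[OF fin, of \<omega> Y "{s}"] N by (intro divide_pos_pos) simp_all
    then show "ln (card \<Omega> / card (fib \<Omega> Y {s} \<omega>)) \<le> card \<Omega> / card (fib \<Omega> Y {s} \<omega>)"
      using ln_le_minus_one by fastforce
  qed
  also have "\<dots> = (\<Sum>v\<in>Y s ` \<Omega>. \<Sum>\<omega>\<in>{\<omega>\<in>\<Omega>. Y s \<omega> = v}. card \<Omega> / card (fib \<Omega> Y {s} \<omega>))"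
    using fin by (rule sum.image_gen)
  also have "\<dots> = (\<Sum>v\<in>Y s ` \<Omega>. real (card \<Omega>))"
  proof (rule sum.cong[OF refl])
    fix v assume "v \<in> Y s ` \<Omega>"
    then have ne: "{\<omega>\<in>\<Omega>. Y s \<omega> = v} \<noteq> {}" by auto
    have "(\<Sum>\<omega>\<in>{\<omega>\<in>\<Omega>. Y s \<omega> = v}. card \<Omega> / card (fib \<Omega> Y {s} \<omega>))
      = (\<Sum>\<omega>\<in>{\<omega>\<in>\<Omega>. Y s \<omega> = v}. card \<Omega> / card {\<omega>\<in>\<Omega>. Y s \<omega> = v})"
      by (rule sum.cong) (auto simp: fib_def)
    also have "\<dots> = card \<Omega>" using ne fin by (simp add: card_gt_0_iff)
    finally show "(\<Sum>\<omega>\<in>{\<omega>\<in>\<Omega>. Y s \<omega> = v}. card \<Omega> / card (fib \<Omega> Y {s} \<omega>)) = real (card \<Omega>)" .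
  qed
  also have "\<dots> \<le> real r * card \<Omega>" using r by (simp add: mult_right_mono)
  finally show ?thesis using N by (simp add: ent_def divide_le_eq)
qed

text \<open>Subadditivity, from submodularity by dropping the nonnegative intersection term. The
  bound depends only on alphabet sizes, which later allows convergent subsequences to be
  extracted.\<close>

lemma ent_le_sum:
  fixes r :: "'s \<Rightarrow> nat"
  assumes fin: "finite \<Omega>" "finite S" and r: "\<And>s. s \<in> S \<Longrightarrow> card (Y s ` \<Omega>) \<le> r s"
  shows "ent \<Omega> Y S \<le> (\<Sum>s\<in>S. real (r s))"
  using fin(2) r
proof (induction S)
  case empty then show ?case by (simp add: ent_empty)
next
  case (insert s S)
  have "ent \<Omega> Y (insert s S) + ent \<Omega> Y ({s} \<inter> S) \<le> ent \<Omega> Y {s} + ent \<Omega> Y S"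
    using ent_submodular[OF fin(1), of Y "{s}" S] by simp
  moreover have "ent \<Omega> Y {s} \<le> r s" using insert fin by (intro ent_singleton_le) auto
  ultimately show ?case
    using insert ent_nonneg[OF fin(1), of Y "{s} \<inter> S"] by (auto simp: algebra_simps)
qed

text \<open>If no atom were split by the new variable, the entropies would coincide. This turns an
  entropy inequality back into two concrete points of \<Omega>.\<close>

lemma ent_less_insertD:
  assumes "finite \<Omega>" and less: "ent \<Omega> Y S < ent \<Omega> Y (insert p S)"
  obtains \<omega> \<omega>' where "\<omega> \<in> \<Omega>" "\<omega>' \<in> \<Omega>" "\<And>s. s \<in> S \<Longrightarrow> Y s \<omega> = Y s \<omega>'" "Y p \<omega> \<noteq> Y p \<omega>'"
proof -
  have "\<exists>\<omega>\<in>\<Omega>. fib \<Omega> Y (insert p S) \<omega> \<noteq> fib \<Omega> Y S \<omega>"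
  proof (rule ccontr)
    assume "\<not> ?thesis"
    then have "ent \<Omega> Y S = ent \<Omega> Y (insert p S)" by (simp add: ent_def)
    then show False using less by simp
  qed
  then obtain \<omega> where w: "\<omega> \<in> \<Omega>" "fib \<Omega> Y (insert p S) \<omega> \<noteq> fib \<Omega> Y S \<omega>" ..
  have "fib \<Omega> Y (insert p S) \<omega> \<subseteq> fib \<Omega> Y S \<omega>"
    by (rule fib_antimono) auto
  with w(2) obtain \<omega>' where "\<omega>' \<in> fib \<Omega> Y S \<omega>" "\<omega>' \<notin> fib \<Omega> Y (insert p S) \<omega>"
    by auto
  with w(1) show thesis by (intro that[of \<omega> \<omega>']) (auto simp: fib_def)
qed

text \<open>The bits of a uniformly random subset of \<open>J\<close> are independent and fair, so
  each point of \<open>J\<close> that is observed contributes \<open>ln 2\<close>, however many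
  \<open>s\<close> observe it.\<close>

lemma ent_Pow:
  fixes J :: "'b set"
  assumes fin: "finite J"
    and Y: "\<And>s \<sigma> \<sigma>'. s \<in> S \<Longrightarrow> Y s \<sigma> = Y s \<sigma>' \<longleftrightarrow> (\<phi> s \<in> J \<inter> \<sigma> \<longleftrightarrow> \<phi> s \<in> J \<inter> \<sigma>')"
  shows "ent (Pow J) Y S = card (J \<inter> \<phi> ` S) * ln 2"
proof -
  have card_fib: "card (fib (Pow J) Y S \<sigma>) = 2 ^ card (J - \<phi> ` S)" if s: "\<sigma> \<subseteq> J" for \<sigma>
  proof -
    have "fib (Pow J) Y S \<sigma> = (\<lambda>\<tau>. \<tau> \<union> (\<sigma> \<inter> \<phi> ` S)) ` Pow (J - \<phi> ` S)"
    proof (intro set_eqI iffI)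
      fix \<tau> assume t: "\<tau> \<in> fib (Pow J) Y S \<sigma>"
      then have "\<tau> \<subseteq> J" "\<tau> \<inter> \<phi> ` S = \<sigma> \<inter> \<phi> ` S"
        using s Y by (auto simp: fib_def)
      then have "\<tau> = (\<tau> - \<phi> ` S) \<union> (\<sigma> \<inter> \<phi> ` S)" "\<tau> - \<phi> ` S \<subseteq> J - \<phi> ` S" by auto
      then show "\<tau> \<in> (\<lambda>\<tau>. \<tau> \<union> (\<sigma> \<inter> \<phi> ` S)) ` Pow (J - \<phi> ` S)" by blast
    next
      fix \<tau> assume "\<tau> \<in> (\<lambda>\<tau>. \<tau> \<union> (\<sigma> \<inter> \<phi> ` S)) ` Pow (J - \<phi> ` S)"
      then show "\<tau> \<in> fib (Pow J) Y S \<sigma>" using s Y by (auto simp: fib_def)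
    qed
    moreover have "inj_on (\<lambda>\<tau>. \<tau> \<union> (\<sigma> \<inter> \<phi> ` S)) (Pow (J - \<phi> ` S))"
      by (rule inj_onI) blast
    ultimately show ?thesis using fin by (simp add: card_image card_Pow)
  qed
  have "card J = card (J \<inter> \<phi> ` S) + card (J - \<phi> ` S)"
    using fin by (metis card_Int_Diff)
  then have "real (card (Pow J)) / 2 ^ card (J - \<phi> ` S) = 2 ^ card (J \<inter> \<phi> ` S)"
    using fin by (simp add: card_Pow power_add)
  then show ?thesis using fin
    by (simp add: ent_def card_fib card_Pow ln_realpow)
qed

section \<open>Shift-invariant submodular set functions\<close>

text \<open>A pair \<open>(k, s)\<close> stands for the variable of row \<open>k\<close> at time
  \<open>s\<close>; translation acts on the time only.\<close>

definition shift :: "nat \<Rightarrow> (nat \<times> nat) set \<Rightarrow> (nat \<times> nat) set" where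
  "shift t A = (\<lambda>(k, s). (k, s + t)) ` A"

definition block :: "(nat \<times> nat) set \<Rightarrow> nat set \<Rightarrow> (nat \<times> nat) set" where
  "block A I = (\<Union>t\<in>I. shift t A)"

section \<open>Calculus of shifts and blocks\<close>

lemma finite_shift [simp]: "finite A \<Longrightarrow> finite (shift t A)"
  by (simp add: shift_def)

lemma finite_block [simp]: "finite A \<Longrightarrow> finite I \<Longrightarrow> finite (block A I)"
  by (simp add: block_def)

lemma shift_shift: "shift s (shift t A) = shift (s + t) A"
  by (auto simp: shift_def image_image case_prod_unfold ac_simps)

lemma shift_0 [simp]: "shift 0 A = A"
  by (simp add: shift_def)

lemma shift_Un: "shift t (A \<union> B) = shift t A \<union> shift t B"
  by (simp add: shift_def image_Un)

lemma shift_Int: "shift t (A \<inter> B) = shift t A \<inter> shift t B"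
  by (auto simp: shift_def)

lemma shift_mono: "A \<subseteq> B \<Longrightarrow> shift t A \<subseteq> shift t B"
  by (auto simp: shift_def)

lemma shift_block: "shift s (block A I) = block A ((+) s ` I)"
proof -
  have "shift s (block A I) = (\<Union>t\<in>I. shift s (shift t A))"
    unfolding shift_def block_def by (rule image_UN)
  then show ?thesis by (simp add: block_def shift_shift)
qed

lemma block_shift: "block (shift s A) I = block A ((+) s ` I)"
  by (auto simp: block_def shift_shift add.commute)

lemma block_Un_left: "block (A \<union> B) I = block A I \<union> block B I"
  by (auto simp: block_def shift_Un)

lemma block_Un: "block A (I \<union> J) = block A I \<union> block A J"
  by (auto simp: block_def)

lemma block_mono: "I \<subseteq> J \<Longrightarrow> block A I \<subseteq> block A J"
  by (auto simp: block_def)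

lemma block_singleton [simp]: "block A {t} = shift t A"
  by (simp add: block_def)

lemma block_empty [simp]: "block A {} = {}"
  by (simp add: block_def)

text \<open>The properties of the joint entropy of a stationary process that survive limits of
  averaged entropies. They are stated for finite index sets because the limit is taken
  there.\<close>

locale shift_submodular =
  fixes E :: "(nat \<times> nat) set \<Rightarrow> real"
  assumes E_empty: "E {} = 0"
    and E_mono: "finite B \<Longrightarrow> A \<subseteq> B \<Longrightarrow> E A \<le> E B"
    and E_submod: "finite A \<Longrightarrow> finite B \<Longrightarrow> E (A \<union> B) + E (A \<inter> B) \<le> E A + E B"
    and E_shift_1: "finite A \<Longrightarrow> E (shift 1 A) = E A"
begin

lemma E_shift: "finite A \<Longrightarrow> E (shift t A) = E A"
proof (induction t)
  case (Suc t)
  then have "E (shift (1 + t) A) = E A"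
    unfolding shift_shift[symmetric] by (simp add: E_shift_1 del: One_nat_def)
  then show ?case by simp
qed simp

section \<open>Conditional entropy and entropy rate\<close>

definition cond :: "(nat \<times> nat) set \<Rightarrow> (nat \<times> nat) set \<Rightarrow> real" where
  "cond A B = E (A \<union> B) - E B"

lemma cond_nonneg: "finite A \<Longrightarrow> finite B \<Longrightarrow> 0 \<le> cond A B"
  by (simp add: cond_def E_mono)

text \<open>Submodularity for \<open>A \<union> B\<close> and \<open>B'\<close>, whose intersection
  contains \<open>B\<close>.\<close>

lemma cond_antimono:
  assumes "finite A" "finite B'" "B \<subseteq> B'"
  shows "cond A B' \<le> cond A B"
proof -
  have finB: "finite B" using assms finite_subset by blast
  have "E ((A \<union> B) \<union> B') + E ((A \<union> B) \<inter> B') \<le> E (A \<union> B) + E B'"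
    using assms finB by (intro E_submod) auto
  moreover have "(A \<union> B) \<union> B' = A \<union> B'" using assms by auto
  moreover have "E B \<le> E ((A \<union> B) \<inter> B')" using assms by (intro E_mono) auto
  ultimately show ?thesis by (simp add: cond_def)
qed

lemma cond_shift: "finite A \<Longrightarrow> finite B \<Longrightarrow> cond (shift t A) (shift t B) = cond A B"
  by (simp add: cond_def shift_Un[symmetric] E_shift)

lemma cond_chain: "cond (A \<union> B) C = cond B C + cond A (B \<union> C)"
  by (simp add: cond_def Un_assoc)

text \<open>Entropy rate as the entropy of the present given the future; the conditional entropies
  decrease with the horizon \<open>M\<close>, so the infimum is their limit.\<close>

definition rate :: "(nat \<times> nat) set \<Rightarrow> real" where
  "rate A = (INF M. cond A (block A {1..M}))"

lemma rate_le: "finite A \<Longrightarrow> rate A \<le> cond A (block A {1..M})"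
  unfolding rate_def by (rule cINF_lower) (auto intro!: bdd_belowI2[of _ 0] cond_nonneg)

lemma rate_approx:
  assumes "finite A" "e > 0"
  obtains N where "\<And>M. N \<le> M \<Longrightarrow> cond A (block A {1..M}) < rate A + e"
proof -
  have "\<exists>N. cond A (block A {1..N}) < rate A + e"
  proof (rule ccontr)
    assume "\<not> ?thesis"
    then have "rate A + e \<le> rate A"
      unfolding rate_def[of A] by (intro cINF_greatest) (auto simp: not_less)
    then show False using assms by simp
  qed
  then obtain N where N: "cond A (block A {1..N}) < rate A + e" ..
  show thesis
  proof (rule that[of N])
    fix M assume "N \<le> M"
    then have "cond A (block A {1..M}) \<le> cond A (block A {1..N})"
      using assms by (intro cond_antimono block_mono) auto
    then show "cond A (block A {1..M}) < rate A + e" using N by simp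
  qed
qed

text \<open>Chain rule splitting off the first letter; the remaining letters are a translate of the
  shorter block.\<close>

lemma E_block_Suc:
  assumes "finite A"
  shows "E (block A {0..<Suc M}) = E (block A {0..<M}) + cond A (block A {1..M})"
proof -
  have "block A {0..<Suc M} = A \<union> block A {1..M}"
  proof -
    have "{0..<Suc M} = {0} \<union> {1..M}" by auto
    then show ?thesis by (simp only: block_Un block_singleton shift_0)
  qed
  moreover have "block A {1..M} = shift 1 (block A {0..<M})"
    by (simp only: shift_block) (simp add: atLeastLessThanSuc_atLeastAtMost)
  then have "E (block A {1..M}) = E (block A {0..<M})"
    using assms by (simp add: E_shift)
  ultimately show ?thesis by (simp add: cond_def)
qed

lemma E_block_ge:
  assumes "finite A"
  shows "E (block A {0..<M}) + a * rate A \<le> E (block A {0..<M + a})"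
proof (induction a)
  case (Suc a)
  then show ?case
    using E_block_Suc[OF assms, of "M + a"] rate_le[OF assms, of "M + a"]
    by (simp add: algebra_simps)
qed simp

lemma E_block_le:
  assumes "finite A" "\<And>M. N \<le> M \<Longrightarrow> cond A (block A {1..M}) < r"
  shows "E (block A {0..<N + a}) \<le> E (block A {0..<N}) + a * r"
proof (induction a)
  case (Suc a)
  then show ?case
    using E_block_Suc[OF assms(1), of "N + a"] assms(2)[of "N + a"]
    by (simp add: algebra_simps)
qed simp

text \<open>From time \<open>N\<close> on, each further letter adds less than
  \<open>rate A + e / 2\<close>, so the excess of the initial block is diluted over a long enough
  block.\<close>

lemma E_block_mean_approx:
  assumes "finite A" "e > 0"
  obtains a where "a > 0" "E (block A {0..<a}) \<le> a * (rate A + e)"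
proof -
  obtain N where N: "\<And>M. N \<le> M \<Longrightarrow> cond A (block A {1..M}) < rate A + e / 2"
    using rate_approx[OF assms(1), of "e / 2"] assms(2) by auto
  \<comment> \<open>The excess of the first \<open>N\<close> letters over the target slope; it must
    be at most \<open>a * (e / 2)\<close>.\<close>
  define K where "K = E (block A {0..<N}) - real N * (rate A + e / 2)"
  obtain b :: nat where b: "2 * K / e < b" using reals_Archimedean2 by blast
  define a where "a = N + Suc b"
  have "K \<le> real a * (e / 2)"
  proof -
    have "2 * K / e < a" using b by (simp add: a_def)
    then show ?thesis using assms(2) by (simp add: field_simps)
  qed
  then have "E (block A {0..<a}) \<le> a * (rate A + e)"
    using E_block_le[of A N "rate A + e / 2" "Suc b", OF assms(1) N]
    by (simp add: a_def K_def algebra_simps add_divide_distrib)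
  then show thesis by (intro that[of a]) (simp_all add: a_def)
qed

text \<open>Chain rule with the letters added from the last to the first, so that each is
  conditioned on the later ones and on \<open>R\<close>.\<close>

lemma cond_block_le:
  assumes "finite A" "finite R" and c: "\<And>t. t < a \<Longrightarrow> cond (shift t A) (block A {Suc t..<a} \<union> R) \<le> c"
  shows "cond (block A {0..<a}) R \<le> a * c"
proof -
  have "cond (block A {a - b..<a}) R \<le> b * c" if "b \<le> a" for b
    using that
  proof (induction b)
    case 0 then show ?case by (simp add: cond_def)
  next
    case (Suc b)
    let ?t = "a - Suc b"
    have "{?t..<a} = {?t} \<union> {Suc ?t..<a}" using Suc.prems by auto
    then have "cond (block A {?t..<a}) R
       = cond (block A {Suc ?t..<a}) R + cond (shift ?t A) (block A {Suc ?t..<a} \<union> R)"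
      by (simp only: block_Un block_singleton cond_chain)
    moreover have "Suc ?t = a - b" using Suc.prems by simp
    ultimately show ?case using Suc c[of ?t] by (simp add: algebra_simps)
  qed
  from this[of a] show ?thesis by simp
qed

text \<open>
  The joint process of A and W over a stretch of length a, given everything later, costs at least
  \<^term>\<open>a * rate (A \<union> W)\<close>; bounding the contribution of W by what it costs given A on the
  same stretch alone leaves the stated amount for A given the far future of W.
\<close>

lemma cond_far_future:
  assumes fin: "finite A" "finite W" and a: "a > 0"
  shows "rate A + rate (A \<union> W) - E (block (A \<union> W) {0..<a}) / a
    \<le> cond A (block (A \<union> shift a W) {1..N})"
proof -
  \<comment> \<open>This length makes \<open>R\<close> reach past \<open>t + a + N\<close> for every
    \<open>t < a\<close>, so that it contains every translated condition on \<open>W\<close> used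
    below.\<close>
  define M where "M = a + N"
  define R where "R = block (A \<union> W) {a..<a + M}"
  define c where "c = cond A (block (A \<union> shift a W) {1..N})"
  have finR: "finite R" using fin by (simp add: R_def)
  have "block (A \<union> W) {0..<M + a} = block (A \<union> W) {0..<a} \<union> R"
  proof -
    have "{0..<M + a} = {0..<a} \<union> {a..<a + M}" by auto
    then show ?thesis by (simp only: R_def block_Un)
  qed
  moreover have "R = shift a (block (A \<union> W) {0..<M})"
    by (simp add: R_def shift_block add.commute)
  ultimately have "a * rate (A \<union> W) \<le> cond (block (A \<union> W) {0..<a}) R"
    using E_block_ge[of "A \<union> W" M a] fin by (simp add: cond_def E_shift)
  also have "block (A \<union> W) {0..<a} = block W {0..<a} \<union> block A {0..<a}"
    by (auto simp: block_Un_left)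
  also have "cond (block W {0..<a} \<union> block A {0..<a}) R
     = cond (block A {0..<a}) R + cond (block W {0..<a}) (block A {0..<a} \<union> R)"
    by (rule cond_chain)
  also have "cond (block W {0..<a}) (block A {0..<a} \<union> R) \<le> cond (block W {0..<a}) (block A {0..<a})"
    using fin finR by (intro cond_antimono) auto
  also have "\<dots> = E (block (A \<union> W) {0..<a}) - E (block A {0..<a})"
    by (simp add: cond_def block_Un_left Un_commute)
  finally have 1: "a * rate (A \<union> W)
      \<le> cond (block A {0..<a}) R + (E (block (A \<union> W) {0..<a}) - E (block A {0..<a}))"
    by simp
  have 2: "a * rate A \<le> E (block A {0..<a})"
    using E_block_ge[OF fin(1), of 0 a] by (simp add: E_empty)
  \<comment> \<open>Seen from any time \<open>t < a\<close>, the copies of \<open>W\<close> delayed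
    by \<open>a\<close> start only after the block and hence lie in \<open>R\<close>; the future
    copies of \<open>A\<close> lie partly in the block and partly in \<open>R\<close>.\<close>
  have 3: "cond (block A {0..<a}) R \<le> a * c"
  proof (rule cond_block_le[OF fin(1) finR])
    fix t assume t: "t < a"
    have "shift t (block (A \<union> shift a W) {1..N}) \<subseteq> block A {Suc t..<a} \<union> R"
    proof -
      have 1: "(+) t ` {1..N} \<subseteq> {Suc t..<a} \<union> {a..<a + M}"
        using t by (auto simp: M_def)
      have 2: "(+) t ` (+) a ` {1..N} \<subseteq> {a..<a + M}"
        using t by (auto simp: M_def)
      have "shift t (block (A \<union> shift a W) {1..N})
        = block A ((+) t ` {1..N}) \<union> block W ((+) t ` (+) a ` {1..N})"
        by (simp only: block_Un_left shift_Un block_shift shift_block)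
      also have "\<dots> \<subseteq> block A ({Suc t..<a} \<union> {a..<a + M}) \<union> block W {a..<a + M}"
        by (intro Un_mono block_mono 1 2)
      also have "\<dots> = block A {Suc t..<a} \<union> R"
        by (simp only: R_def block_Un block_Un_left Un_assoc)
      finally show ?thesis .
    qed
    then have "cond (shift t A) (block A {Suc t..<a} \<union> R)
      \<le> cond (shift t A) (shift t (block (A \<union> shift a W) {1..N}))"
      using fin finR by (intro cond_antimono) auto
    also have "\<dots> = c" using fin by (simp add: c_def cond_shift)
    finally show "cond (shift t A) (block A {Suc t..<a} \<union> R) \<le> c" .
  qed
  from 1 2 3 have "a * rate (A \<union> W) \<le> a * c + (E (block (A \<union> W) {0..<a}) - a * rate A)"
    by simp
  then show ?thesis using a unfolding c_def[symmetric] by (simp add: field_simps)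
qed

text \<open>In \<open>cond A B = cond P B + cond A (P \<union> B)\<close> both terms shrink as
  \<open>B\<close> grows, so the loss of the part \<open>P\<close> is at most the loss of the
  whole.\<close>

lemma cond_part_diff_le:
  assumes "finite A" "finite B'" "P \<subseteq> A" "B \<subseteq> B'"
  shows "cond P B - cond P B' \<le> cond A B - cond A B'"
proof -
  have A: "A = A \<union> P" using assms by auto
  have finP: "finite P" using assms finite_subset by blast
  have "cond A (P \<union> B') \<le> cond A (P \<union> B)"
    using assms finP by (intro cond_antimono) auto
  then show ?thesis
    using cond_chain[of A P B] cond_chain[of A P B'] A by simp
qed

text \<open>The delay \<open>a\<close> is a block length at which the mean entropy of
  \<open>A \<union> W\<close> is within \<open>c / 4\<close> of its rate. With
  \<open>cond_far_future\<close> and another \<open>c / 4\<close> for the convergence to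
  \<open>rate A\<close>, the set \<open>A\<close> loses at most \<open>c / 2\<close>, and therefore
  so does \<open>P\<close>. Short horizons follow from long ones by antitonicity.\<close>

lemma positive_cond_extend:
  assumes fin: "finite A" "finite W" and P: "P \<subseteq> A" and c: "c > 0"
    and pos: "\<And>M. c \<le> cond P (block A {1..M})"
  shows "\<exists>a. \<forall>M. c / 2 \<le> cond P (block (A \<union> shift a W) {1..M})"
proof -
  obtain N where N: "\<And>M. N \<le> M \<Longrightarrow> cond A (block A {1..M}) < rate A + c / 4"
    using rate_approx[OF fin(1), of "c / 4"] c by auto
  obtain a where a: "a > 0" "E (block (A \<union> W) {0..<a}) \<le> a * (rate (A \<union> W) + c / 4)"
    using E_block_mean_approx[of "A \<union> W" "c / 4"] fin c by auto
  have finP: "finite P" using P fin finite_subset by blast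
  have big: "c / 2 \<le> cond P (block (A \<union> shift a W) {1..M})" if "N \<le> M" for M
  proof -
    have "E (block (A \<union> W) {0..<a}) / a \<le> rate (A \<union> W) + c / 4"
      using a by (simp add: field_simps)
    then have "rate A - c / 4 \<le> cond A (block (A \<union> shift a W) {1..M})"
      using cond_far_future[OF fin a(1), of M] by linarith
    moreover have "cond P (block A {1..M}) - cond P (block (A \<union> shift a W) {1..M})
      \<le> cond A (block A {1..M}) - cond A (block (A \<union> shift a W) {1..M})"
      using fin P by (intro cond_part_diff_le) (auto simp: block_Un_left)
    ultimately show ?thesis using pos[of M] N[OF that] by linarith
  qed
  have "c / 2 \<le> cond P (block (A \<union> shift a W) {1..M})" for M
  proof -
    have "cond P (block (A \<union> shift a W) {1..max M N}) \<le> cond P (block (A \<union> shift a W) {1..M})"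
      using finP fin by (intro cond_antimono block_mono) auto
    then show ?thesis using big[of "max M N"] by simp
  qed
  then show ?thesis by blast
qed

end

section \<open>Independent times from positive entropy\<close>

text \<open>All 0-1 itineraries along \<open>W\<close> are realised, by points of \<open>V\<close>.
  The set \<open>V\<close> is a parameter so that an induction can restrict to points with a
  prescribed letter at the last time.\<close>

definition independent_times ::
  "('a \<Rightarrow> 'a) \<Rightarrow> 'a set \<Rightarrow> 'a set \<Rightarrow> 'a set \<Rightarrow> nat set \<Rightarrow> bool" where
  "independent_times T A B V W \<longleftrightarrow>
    (\<forall>\<sigma>\<subseteq>W. \<exists>v\<in>V. \<forall>i\<in>W. (T ^^ i) v \<in> (if i \<in> \<sigma> then A else B))"

text \<open>The empty set is a member exactly when \<open>V\<close> is nonempty, which anchors the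
  counting induction.\<close>

definition shattered_sets ::
  "('a \<Rightarrow> 'a) \<Rightarrow> 'a set \<Rightarrow> 'a set \<Rightarrow> 'a set \<Rightarrow> nat \<Rightarrow> nat set set" where
  "shattered_sets T A B V n = {W. W \<subseteq> {..<n} \<and> independent_times T A B V W}"

section \<open>Sauer-Shelah counting of shattered sets\<close>

lemma finite_shattered_sets [simp]: "finite (shattered_sets T A B V n)"
  by (rule finite_subset[of _ "Pow {..<n}"]) (auto simp: shattered_sets_def)

lemma independent_times_mono: "V \<subseteq> V' \<Longrightarrow> independent_times T A B V W \<Longrightarrow> independent_times T A B V' W"
  unfolding independent_times_def by (meson subsetD)

lemma shattered_sets_mono: "V \<subseteq> V' \<Longrightarrow> m \<le> n \<Longrightarrow> shattered_sets T A B V m \<subseteq> shattered_sets T A B V' n"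
  unfolding shattered_sets_def using independent_times_mono[of V V'] by fastforce

lemma independent_times_insert:
  assumes n: "n \<notin> W"
    and A: "independent_times T A B {v\<in>V. (T ^^ n) v \<in> A} W"
    and B: "independent_times T A B {v\<in>V. (T ^^ n) v \<in> B} W"
  shows "independent_times T A B V (insert n W)"
  unfolding independent_times_def
proof (intro allI impI)
  fix \<sigma> assume \<sigma>: "\<sigma> \<subseteq> insert n W"
  let ?C = "if n \<in> \<sigma> then A else B"
  have "independent_times T A B {v\<in>V. (T ^^ n) v \<in> ?C} W"
    using A B by simp
  moreover have "\<sigma> - {n} \<subseteq> W" using \<sigma> by auto
  ultimately obtain v where v: "v \<in> V" "(T ^^ n) v \<in> ?C"
    "\<And>i. i \<in> W \<Longrightarrow> (T ^^ i) v \<in> (if i \<in> \<sigma> - {n} then A else B)"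
    unfolding independent_times_def by (smt (verit) mem_Collect_eq)
  have "(T ^^ i) v \<in> (if i \<in> \<sigma> then A else B)" if "i \<in> insert n W" for i
  proof (cases "i = n")
    case False
    then show ?thesis using that v(3)[of i] by simp
  qed (use v(2) in simp)
  then show "\<exists>v\<in>V. \<forall>i\<in>insert n W. (T ^^ i) v \<in> (if i \<in> \<sigma> then A else B)"
    using v(1) by blast
qed

text \<open>A set shattered by either part is shattered by \<open>V\<close>; a set \<open>W\<close>
  shattered by both also yields \<open>insert n W\<close>. Thus the union and the intersection are
  counted by disjoint families.\<close>

lemma card_shattered_sets_Suc:
  "card (shattered_sets T A B {v\<in>V. (T ^^ n) v \<in> A} n) + card (shattered_sets T A B {v\<in>V. (T ^^ n) v \<in> B} n)
    \<le> card (shattered_sets T A B V (Suc n))"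
proof -
  let ?a = "shattered_sets T A B {v\<in>V. (T ^^ n) v \<in> A} n"
  let ?b = "shattered_sets T A B {v\<in>V. (T ^^ n) v \<in> B} n"
  have nn: "n \<notin> W" if "W \<in> ?a \<union> ?b" for W
    using that by (auto simp: shattered_sets_def)
  have "inj_on (insert n) (?a \<inter> ?b)"
  proof (rule inj_onI)
    fix W W' assume "W \<in> ?a \<inter> ?b" "W' \<in> ?a \<inter> ?b" and eq: "insert n W = insert n W'"
    then have "n \<notin> W" "n \<notin> W'" using nn by simp_all
    then show "W = W'" using eq by (simp add: insert_ident)
  qed
  then have ci: "card (insert n ` (?a \<inter> ?b)) = card (?a \<inter> ?b)"
    by (rule card_image)
  have "card ?a + card ?b = card (?a \<union> ?b) + card (?a \<inter> ?b)"
    by (rule card_Un_Int) auto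
  also have "\<dots> = card ((?a \<union> ?b) \<union> insert n ` (?a \<inter> ?b))"
    unfolding ci[symmetric]
  proof (rule card_Un_disjoint[symmetric])
    have "insert n W \<notin> ?a \<union> ?b" for W
      using nn[of "insert n W"] by blast
    then show "(?a \<union> ?b) \<inter> insert n ` (?a \<inter> ?b) = {}" by auto
  qed auto
  also have "\<dots> \<le> card (shattered_sets T A B V (Suc n))"
  proof (rule card_mono)
    have "insert n W \<in> shattered_sets T A B V (Suc n)" if "W \<in> ?a \<inter> ?b" for W
    proof -
      have "W \<subseteq> {..<n}" using that by (simp add: shattered_sets_def)
      moreover have "independent_times T A B V (insert n W)"
        by (rule independent_times_insert) (use that in \<open>auto simp: shattered_sets_def\<close>)
      ultimately show ?thesis by (auto simp: shattered_sets_def)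
    qed
    moreover have "?a \<subseteq> shattered_sets T A B V (Suc n)" "?b \<subseteq> shattered_sets T A B V (Suc n)"
      by (rule shattered_sets_mono; auto)+
    ultimately show "(?a \<union> ?b) \<union> insert n ` (?a \<inter> ?b) \<subseteq> shattered_sets T A B V (Suc n)"
      by blast
  qed simp
  finally show ?thesis .
qed

text \<open>Pascal's rule summed over \<open>j\<close>: the recursion behind the bound of
  \<open>small_subcover\<close>.\<close>

lemma sum_choose_Suc:
  "(\<Sum>j<k. n choose j) + (\<Sum>j<Suc k. n choose j) = (\<Sum>j<Suc k. Suc n choose j)"
proof (induction k)
  case (Suc k)
  have "(\<Sum>j<Suc k. n choose j) + (\<Sum>j<Suc (Suc k). n choose j)
    = ((\<Sum>j<k. n choose j) + (\<Sum>j<Suc k. n choose j)) + ((n choose k) + (n choose Suc k))"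
    by simp
  also have "\<dots> = (\<Sum>j<Suc (Suc k). Suc n choose j)"
    unfolding Suc.IH by simp
  finally show ?case .
qed simp

lemma cover_join_image_subset:
  assumes "D \<subseteq> C" "U \<in> C'"
  shows "(\<lambda>d. d \<inter> U) ` D \<subseteq> cover_join C C'"
  using assms by (auto simp: cover_join_def)

text \<open>
  A Sauer-Shelah bound for partially defined 0-1 words: a point has the letter 0 or 1 at time i
  according to whether its i-th image is in A or in B, and no letter otherwise. One of the two
  letters at the last time leaves at most half of the shattered sets. The points with that letter
  get it, all others get the opposite letter, so that k decreases along every wrong guess.
\<close>

lemma small_subcover:
  assumes T: "\<And>i x. x \<in> X \<Longrightarrow> (T ^^ i) x \<in> X" and AB: "A \<inter> B = {}"
    and "V \<subseteq> X" and "card (shattered_sets T A B V n) < 2 ^ k"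
  shows "\<exists>D\<subseteq>iterated_join X T {X - A, X - B} n.
    finite D \<and> V \<subseteq> \<Union>D \<and> card D \<le> (\<Sum>j<k. n choose j)"
  using assms(3,4)
proof (induction n arbitrary: V k)
  case 0
  show ?case
  proof (cases "V = {}")
    case False
    then have "{} \<in> shattered_sets T A B V 0"
      by (auto simp: shattered_sets_def independent_times_def)
    then have "card (shattered_sets T A B V 0) > 0" by (auto simp: card_gt_0_iff)
    then have "k > 0" using 0 by (cases k) auto
    then have "(\<Sum>j<k. 0 choose j) \<ge> 1"
      by (cases k) (auto simp: lessThan_Suc_eq_insert_0)
    then show ?thesis using 0 by (intro exI[of _ "{X}"]) auto
  qed (auto intro: exI[of _ "{}"])
next
  case (Suc n)
  let ?J = "\<lambda>m. iterated_join X T {X - A, X - B} m"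
  show ?case
  proof (cases k)
    case 0
    then have "shattered_sets T A B V (Suc n) = {}" using Suc.prems by simp
    then have "V = {}"
      by (auto simp: shattered_sets_def independent_times_def)
    then show ?thesis by (auto intro: exI[of _ "{}"])
  next
    case (Suc l)
    \<comment> \<open>The two counts add up to less than \<open>2 ^ Suc l\<close>, so one of them is
      below \<open>2 ^ l\<close>.\<close>
    have "card (shattered_sets T A B {v\<in>V. (T ^^ n) v \<in> A} n) < 2 ^ l \<or>
          card (shattered_sets T A B {v\<in>V. (T ^^ n) v \<in> B} n) < 2 ^ l"
      using card_shattered_sets_Suc[of T A B V n] Suc.prems Suc by auto
    then obtain P Q where PQ: "(P = A \<and> Q = B) \<or> (P = B \<and> Q = A)"
      and P: "card (shattered_sets T A B {v\<in>V. (T ^^ n) v \<in> P} n) < 2 ^ l" by blast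
    obtain D1 where D1: "D1 \<subseteq> ?J n" "finite D1" "{v\<in>V. (T ^^ n) v \<in> P} \<subseteq> \<Union>D1"
      "card D1 \<le> (\<Sum>j<l. n choose j)"
      using Suc.IH[OF _ P] Suc.prems by blast
    have "card (shattered_sets T A B {v\<in>V. (T ^^ n) v \<notin> P} n) \<le> card (shattered_sets T A B V (Suc n))"
      by (intro card_mono shattered_sets_mono) auto
    also have "\<dots> < 2 ^ k" by (rule Suc.prems)
    finally obtain D2 where D2: "D2 \<subseteq> ?J n" "finite D2" "{v\<in>V. (T ^^ n) v \<notin> P} \<subseteq> \<Union>D2"
      "card D2 \<le> (\<Sum>j<k. n choose j)"
      using Suc.IH[of "{v\<in>V. (T ^^ n) v \<notin> P}" k] Suc.prems by blast
    \<comment> \<open>Points with letter \<open>P\<close> at time \<open>n\<close> avoid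
      \<open>Q\<close> by disjointness and all others avoid \<open>P\<close>; both
      \<open>X - Q\<close> and \<open>X - P\<close> belong to the cover.\<close>
    define E1 where "E1 = (\<lambda>d. d \<inter> (X \<inter> (T ^^ n) -` (X - Q))) ` D1"
    define E2 where "E2 = (\<lambda>d. d \<inter> (X \<inter> (T ^^ n) -` (X - P))) ` D2"
    have "E1 \<subseteq> ?J (Suc n)" "E2 \<subseteq> ?J (Suc n)"
      unfolding E1_def E2_def iterated_join.simps
      by (rule cover_join_image_subset; use D1 D2 PQ in \<open>auto simp: cover_preimage_def\<close>)+
    moreover have "V \<subseteq> \<Union>(E1 \<union> E2)"
    proof
      fix v assume v: "v \<in> V"
      then have vX: "v \<in> X" "(T ^^ n) v \<in> X" using Suc.prems T by auto
      show "v \<in> \<Union>(E1 \<union> E2)"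
      proof (cases "(T ^^ n) v \<in> P")
        case True
        then have "(T ^^ n) v \<notin> Q" using PQ AB by auto
        moreover obtain d where "d \<in> D1" "v \<in> d" using True v D1(3) by blast
        ultimately show ?thesis using vX by (auto simp: E1_def)
      next
        case False
        moreover obtain d where "d \<in> D2" "v \<in> d" using False v D2(3) by blast
        ultimately show ?thesis using vX by (auto simp: E2_def)
      qed
    qed
    moreover have "card (E1 \<union> E2) \<le> (\<Sum>j<k. Suc n choose j)"
    proof -
      have "card (E1 \<union> E2) \<le> card D1 + card D2"
        using card_Un_le[of E1 E2] card_image_le[OF D1(2)] card_image_le[OF D2(2)]
        unfolding E1_def E2_def by (meson add_mono order_trans)
      also have "\<dots> \<le> (\<Sum>j<l. n choose j) + (\<Sum>j<k. n choose j)"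
        using D1(4) D2(4) by (rule add_mono)
      also have "\<dots> = (\<Sum>j<k. Suc n choose j)"
        unfolding Suc by (rule sum_choose_Suc)
      finally show ?thesis .
    qed
    moreover have "finite (E1 \<union> E2)" using D1 D2 by (simp add: E1_def E2_def)
    ultimately show ?thesis by (intro exI[of _ "E1 \<union> E2"]) auto
  qed
qed

lemma iterated_join_subset: "W \<in> iterated_join X T C n \<Longrightarrow> W \<subseteq> X"
  by (induction n arbitrary: W) (auto simp: cover_join_def)

lemma min_subcover_card_le:
  assumes T: "\<And>i x. x \<in> X \<Longrightarrow> (T ^^ i) x \<in> X" and AB: "A \<inter> B = {}"
    and k: "card (shattered_sets T A B X n) < 2 ^ k"
  shows "min_subcover_card X (iterated_join X T {X - A, X - B} n) \<le> (\<Sum>j<k. n choose j)"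
proof -
  obtain D where D: "D \<subseteq> iterated_join X T {X - A, X - B} n" "finite D" "X \<subseteq> \<Union>D"
    "card D \<le> (\<Sum>j<k. n choose j)"
    using small_subcover[of X T A B X n k] assms by blast
  have "\<Union>D = X" using D iterated_join_subset by blast
  then have "min_subcover_card X (iterated_join X T {X - A, X - B} n) \<le> card D"
    unfolding min_subcover_card_def using D by (intro Least_le) blast
  then show ?thesis using D(4) by simp
qed

text \<open>Chernoff-type bound: for \<open>x < 1\<close> the sum times \<open>x ^ k\<close> is at
  most \<open>(1 + x) ^ n \<le> exp (n * x)\<close>. The choice of \<gamma> makes
  \<open>x ^ k\<close> at least \<open>exp (- c * n / 2)\<close>.\<close>

lemma sum_choose_le_exp:
  fixes c :: real
  assumes c: "c > 0"
  obtains \<gamma> where "\<gamma> > 0"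
    "\<And>n k :: nat. real k \<le> \<gamma> * real n \<Longrightarrow> real (\<Sum>j\<le>k. n choose j) \<le> exp (c * real n)"
proof -
  define x where "x = min (c / 2) (1 / 2)"
  have x: "0 < x" "x < 1" "x \<le> c / 2" using c by (auto simp: x_def)
  define \<gamma> where "\<gamma> = c / (2 * (- ln x))"
  have lnx: "ln x < 0" using x by simp
  have g: "\<gamma> > 0" "\<gamma> * ln x = - c / 2" using lnx c by (auto simp: \<gamma>_def field_simps)
  show thesis
  proof (rule that[of \<gamma>])
    fix n k :: nat assume k: "real k \<le> \<gamma> * real n"
    have "real (\<Sum>j\<le>k. n choose j) * x ^ k = (\<Sum>j\<le>k. real (n choose j) * x ^ k)"
      by (simp add: sum_distrib_right)
    also have "\<dots> \<le> (\<Sum>j\<le>k. real (n choose j) * x ^ j)"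
      using x by (intro sum_mono mult_left_mono power_decreasing) auto
    \<comment> \<open>Since \<gamma> may exceed 1, \<open>k\<close> may exceed \<open>n\<close>; the
      binomial coefficients beyond \<open>n\<close> vanish.\<close>
    also have "\<dots> \<le> (\<Sum>j\<le>max k n. real (n choose j) * x ^ j)"
      using x by (intro sum_mono2) auto
    also have "\<dots> = (\<Sum>j\<le>n. real (n choose j) * x ^ j)"
      by (intro sum.mono_neutral_right) (auto simp: binomial_eq_0)
    also have "\<dots> = (x + 1) ^ n" by (subst binomial_ring) simp
    also have "\<dots> \<le> exp x ^ n"
      using x exp_ge_add_one_self[of x] by (intro power_mono) (simp_all add: add.commute)
    also have "\<dots> = exp (real n * x)" by (simp add: exp_of_nat_mult)
    also have "\<dots> \<le> exp (c / 2 * real n)"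
      using mult_left_mono[OF x(3), of "real n"] by (simp add: mult.commute)
    finally have "real (\<Sum>j\<le>k. n choose j) * x ^ k \<le> exp (c / 2 * real n)" .
    moreover have "exp (- (c / 2 * real n)) \<le> x ^ k"
    proof -
      have "\<gamma> * real n * ln x \<le> real k * ln x" using k lnx by (simp add: mult_right_mono_neg)
      moreover have "\<gamma> * real n * ln x = - (c / 2 * real n)"
        using arg_cong[OF g(2), of "\<lambda>y. y * real n"] by (simp add: mult_ac)
      moreover have "x ^ k = exp (real k * ln x)" using x by (simp add: exp_of_nat_mult)
      ultimately show ?thesis by simp
    qed
    ultimately have "real (\<Sum>j\<le>k. n choose j) * exp (- (c / 2 * real n)) \<le> exp (c / 2 * real n)"
      by (meson mult_left_mono of_nat_0_le_iff order_trans)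
    then have "real (\<Sum>j\<le>k. n choose j) \<le> exp (c / 2 * real n) * exp (c / 2 * real n)"
      by (simp add: exp_minus field_simps del: of_nat_sum)
    then show "real (\<Sum>j\<le>k. n choose j) \<le> exp (c * real n)"
      by (simp add: exp_add[symmetric] del: of_nat_sum)
  qed (rule g)
qed

text \<open>Contrapositive: if every exponential lower bound fails from some \<open>n\<close> on,
  the quotients converge to 0, and so \<open>lim\<close> is 0.\<close>

lemma cover_entropy_pos_imp_exp_growth:
  assumes pos: "cover_entropy X T C > 0"
  obtains c where "c > 0"
    "\<And>m. \<exists>n\<ge>m. exp (c * real n) \<le> real (min_subcover_card X (iterated_join X T C n))"
proof -
  let ?N = "\<lambda>n. min_subcover_card X (iterated_join X T C n)"
  have "\<exists>c>0. \<forall>m. \<exists>n\<ge>m. exp (c * real n) \<le> real (?N n)"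
  proof (rule ccontr)
    assume not: "\<not> ?thesis"
    have "(\<lambda>n. ln (real (?N n)) / real n) \<longlonglongrightarrow> 0"
    proof (rule LIMSEQ_I)
      fix e :: real assume e: "e > 0"
      then obtain m where m: "\<And>n. m \<le> n \<Longrightarrow> real (?N n) < exp (e * real n)"
        using not by (meson not_le)
      show "\<exists>m. \<forall>n\<ge>m. norm (ln (real (?N n)) / real n - 0) < e"
      proof (intro exI[of _ "Suc m"] allI impI)
        fix n assume n: "Suc m \<le> n"
        \<comment> \<open>A count of 0 is covered by the convention \<open>ln 0 = 0\<close>.\<close>
        have "ln (real (?N n)) \<ge> 0"
          by (cases "?N n") auto
        moreover have "ln (real (?N n)) < e * real n"
        proof (cases "?N n = 0")
          case False
          then have "ln (real (?N n)) < ln (exp (e * real n))"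
            using m[of n] n by (subst ln_less_cancel_iff) auto
          then show ?thesis by simp
        qed (use e n in simp)
        ultimately show "norm (ln (real (?N n)) / real n - 0) < e"
          using n by (simp add: divide_less_eq)
      qed
    qed
    then have "cover_entropy X T C = 0" unfolding cover_entropy_def by (rule limI)
    then show False using pos by simp
  qed
  then show thesis using that by blast
qed

lemma card_bounded_subsets_le:
  "card {W. W \<subseteq> {..<n} \<and> card W \<le> k} \<le> (\<Sum>j\<le>k. n choose j)"
proof -
  have "{W. W \<subseteq> {..<n} \<and> card W \<le> k} = (\<Union>j\<le>k. {W. W \<subseteq> {..<n} \<and> card W = j})" by auto
  also have "card \<dots> \<le> (\<Sum>j\<le>k. card {W. W \<subseteq> {..<n} \<and> card W = j})"
    by (rule card_UN_le) simp
  also have "\<dots> = (\<Sum>j\<le>k. n choose j)"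
    by (simp add: n_subsets)
  finally show ?thesis .
qed

text \<open>The binomial estimate is used twice. Fewer than \<open>2 ^ k\<close> shattered sets,
  with \<open>k\<close> close to \<open>\<gamma> * n\<close>, would give too small a subcover; and
  if all shattered sets had fewer than \<open>\<delta> * n\<close> elements, there would be too few
  of them.\<close>

lemma positive_entropy_imp_independence:
  assumes T: "\<And>i x. x \<in> X \<Longrightarrow> (T ^^ i) x \<in> X" and AB: "A \<inter> B = {}"
    and pos: "cover_entropy X T {X - A, X - B} > 0"
  obtains \<delta> where "\<delta> > 0"
    "\<And>m. \<exists>n\<ge>m. \<exists>J\<subseteq>{..<n}. \<delta> * real n \<le> real (card J) \<and> independent_times T A B X J"
proof -
  let ?N = "\<lambda>n. min_subcover_card X (iterated_join X T {X - A, X - B} n)"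
  obtain c where c: "c > 0" and grow: "\<And>m. \<exists>n\<ge>m. exp (c * real n) \<le> real (?N n)"
    using cover_entropy_pos_imp_exp_growth[OF pos] by blast
  obtain \<gamma> where g: "\<gamma> > 0"
    and g_le: "\<And>n k :: nat. real k \<le> \<gamma> * real n \<Longrightarrow> real (\<Sum>j\<le>k. n choose j) \<le> exp (c / 2 * real n)"
    using sum_choose_le_exp[of "c / 2"] c by auto
  obtain \<delta> where d: "\<delta> > 0"
    and d_le: "\<And>n k :: nat. real k \<le> \<delta> * real n \<Longrightarrow> real (\<Sum>j\<le>k. n choose j) \<le> exp (\<gamma> * ln 2 / 2 * real n)"
    using sum_choose_le_exp[of "\<gamma> * ln 2 / 2"] g by auto
  show thesis
  proof (rule that[OF d])
    fix m :: nat
    \<comment> \<open>For \<open>n > 2 / \<gamma>\<close> the rounding loss in \<open>k\<close> is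
      less than half of \<open>\<gamma> * n\<close>.\<close>
    obtain m0 :: nat where m0: "2 / \<gamma> < m0" using reals_Archimedean2 by blast
    obtain n where n: "n \<ge> max m (Suc m0)" and exp_le: "exp (c * real n) \<le> real (?N n)"
      using grow[of "max m (Suc m0)"] by blast
    have n0: "n > 0" using n by simp
    define k where "k = nat \<lfloor>\<gamma> * real n\<rfloor>"
    have k: "real k \<le> \<gamma> * real n" "\<gamma> * real n - 1 < real k"
      using g by (auto simp: k_def)
    have sh: "2 ^ k \<le> card (shattered_sets T A B X n)"
    proof (rule ccontr)
      assume "\<not> ?thesis"
      then have "?N n \<le> (\<Sum>j<k. n choose j)"
        by (intro min_subcover_card_le[OF T AB]) auto
      also have "\<dots> \<le> (\<Sum>j\<le>k. n choose j)" by (intro sum_mono2) auto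
      finally have "real (?N n) \<le> exp (c / 2 * real n)"
        using g_le[OF k(1)] by linarith
      also have "\<dots> < exp (c * real n)" using c n0 by simp
      finally show False using exp_le by simp
    qed
    have "\<exists>J\<in>shattered_sets T A B X n. \<delta> * real n \<le> real (card J)"
    proof (rule ccontr)
      assume small: "\<not> ?thesis"
      define l where "l = nat \<lfloor>\<delta> * real n\<rfloor>"
      have l: "real l \<le> \<delta> * real n" using d by (auto simp: l_def)
      have "shattered_sets T A B X n \<subseteq> {W. W \<subseteq> {..<n} \<and> card W \<le> l}"
      proof
        fix W assume W: "W \<in> shattered_sets T A B X n"
        then have "real (card W) < \<delta> * real n" using small by force
        then have "card W \<le> l" unfolding l_def by linarith
        then show "W \<in> {W. W \<subseteq> {..<n} \<and> card W \<le> l}"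
          using W by (simp add: shattered_sets_def)
      qed
      then have "card (shattered_sets T A B X n) \<le> card {W. W \<subseteq> {..<n} \<and> card W \<le> l}"
        by (intro card_mono) auto
      also have "\<dots> \<le> (\<Sum>j\<le>l. n choose j)" by (rule card_bounded_subsets_le)
      finally have "real (2 ^ k) \<le> exp (\<gamma> * ln 2 / 2 * real n)"
        using sh d_le[OF l] by linarith
      moreover have "real (2 ^ k) = exp (real k * ln 2)" by (simp add: exp_of_nat_mult)
      ultimately have "real k * ln 2 \<le> (\<gamma> / 2 * real n) * ln 2" by (simp add: mult.commute mult.left_commute)
      then have "real k \<le> \<gamma> / 2 * real n" by simp
      then have "\<gamma> * real n < 2" using k(2) by simp
      moreover have "2 / \<gamma> < real n" using m0 n by simp
      ultimately show False using g by (simp add: field_simps)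
    qed
    then show "\<exists>n\<ge>m. \<exists>J\<subseteq>{..<n}. \<delta> * real n \<le> real (card J) \<and> independent_times T A B X J"
      using n by (auto simp: shattered_sets_def)
  qed
qed

section \<open>Asymptotic pairs from independent times\<close>

text \<open>Diagonal argument over the countably many finite sets; division by
  \<open>1 + C S\<close> makes the bound uniform, as the diagonal lemma requires.\<close>

lemma bounded_family_convergent_subseq:
  fixes G :: "nat \<Rightarrow> 's::countable set \<Rightarrow> real"
  assumes bound: "\<And>j S. finite S \<Longrightarrow> \<bar>G j S\<bar> \<le> C S"
  obtains r E where "strict_mono (r :: nat \<Rightarrow> nat)" "\<And>S. finite S \<Longrightarrow> (\<lambda>j. G (r j) S) \<longlonglongrightarrow> E S"
proof -
  have C: "C S \<ge> 0" if "finite S" for S using bound[OF that, of 0] by linarith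
  have "norm (G j S / (1 + C S)) \<le> 1" if "S \<in> Collect finite" for j S
    using that bound[of S j] C[of S] by (simp add: divide_le_eq)
  then obtain r :: "nat \<Rightarrow> nat" where r: "strict_mono r"
    and conv: "\<And>S. S \<in> Collect finite \<Longrightarrow> \<exists>l. (\<lambda>j. G (r j) S / (1 + C S)) \<longlonglongrightarrow> l"
    using function_convergent_subsequence[of "Collect finite" "\<lambda>j S. G j S / (1 + C S)" 1]
      countable_Collect_finite by blast
  have "\<exists>l. (\<lambda>j. G (r j) S) \<longlonglongrightarrow> l" if S: "finite S" for S
  proof -
    obtain l where "(\<lambda>j. G (r j) S / (1 + C S)) \<longlonglongrightarrow> l" using conv S by blast
    then have "(\<lambda>j. (1 + C S) * (G (r j) S / (1 + C S))) \<longlonglongrightarrow> (1 + C S) * l"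
      by (rule tendsto_mult_left)
    then show ?thesis using C[OF S] by auto
  qed
  then obtain E where "\<And>S. finite S \<Longrightarrow> (\<lambda>j. G (r j) S) \<longlonglongrightarrow> E S" by metis
  then show thesis using that r by blast
qed

text \<open>Each point is coded by the number of the centre of an \<open>e / 2\<close>-ball
  containing it.\<close>

lemma compact_finite_coding:
  fixes X :: "'a::metric_space set"
  assumes X: "compact X" and e: "e > 0"
  obtains q :: "'a \<Rightarrow> nat" and r :: nat where "\<And>x. x \<in> X \<Longrightarrow> q x < r"
    "\<And>x y. x \<in> X \<Longrightarrow> y \<in> X \<Longrightarrow> q x = q y \<Longrightarrow> dist x y < e"
proof -
  obtain K where K: "finite K" "X \<subseteq> (\<Union>c\<in>K. ball c (e / 2))"
    using X e unfolding compact_eq_totally_bounded by (meson half_gt_zero)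
  obtain f where f: "bij_betw f K {0..<card K}"
    using ex_bij_betw_finite_nat[OF K(1)] by blast
  have "\<forall>x\<in>X. \<exists>c. c \<in> K \<and> dist c x < e / 2" using K(2) by fastforce
  then obtain g where g: "\<And>x. x \<in> X \<Longrightarrow> g x \<in> K \<and> dist (g x) x < e / 2" by metis
  show thesis
  proof (rule that[of "f \<circ> g" "card K"])
    show "(f \<circ> g) x < card K" if "x \<in> X" for x
      using g[OF that] bij_betwE[OF f] by auto
    show "dist x y < e" if "x \<in> X" "y \<in> X" "(f \<circ> g) x = (f \<circ> g) y" for x y
    proof -
      have "g x = g y" using f that g unfolding bij_betw_def inj_on_def by auto
      then show ?thesis using g[OF that(1)] g[OF that(2)]
        by (metis dist_commute dist_triangle_half_l)
    qed
  qed
qed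

lemma inj_on_shift: "inj_on (\<lambda>(k, s). (k, s + t)) (A :: (nat \<times> nat) set)"
  by (auto simp: inj_on_def)

text \<open>The delays \<open>a k\<close> are fixed before the horizon \<open>K\<close>; this
  uniformity is what makes a limit point over \<open>K\<close> asymptotic.\<close>

lemma eventually_agreeing_codes:
  fixes X :: "'a set" and q :: "nat \<Rightarrow> 'a \<Rightarrow> nat"
  assumes T: "\<And>i x. x \<in> X \<Longrightarrow> (T ^^ i) x \<in> X" and d: "\<delta> > 0"
    and indep: "\<And>m. \<exists>n\<ge>m. \<exists>J\<subseteq>{..<n}. \<delta> * real n \<le> real (card J) \<and> independent_times T A B X J"
    and q: "\<And>k x. x \<in> X \<Longrightarrow> q k x < r k"
  obtains a :: "nat \<Rightarrow> nat" where
    "\<And>K. \<exists>u\<in>X \<inter> A. \<exists>v\<in>X \<inter> B. \<forall>k<K. \<forall>t\<in>{1..K}. q k ((T ^^ (a k + t)) u) = q k ((T ^^ (a k + t)) v)"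
proof -
  have "\<exists>n J. Suc j \<le> n \<and> J \<subseteq> {..<n} \<and> \<delta> * real n \<le> real (card J) \<and> independent_times T A B X J" for j
    using indep[of "Suc j"] by blast
  then obtain N J where N: "\<And>j. Suc j \<le> N j" and J: "\<And>j. J j \<subseteq> {..<N j}"
    and dJ: "\<And>j. \<delta> * real (N j) \<le> real (card (J j))" and ind: "\<And>j. independent_times T A B X (J j)"
    by metis
  have finJ: "finite (J j)" for j using J finite_subset by blast
  have "\<exists>p. \<forall>\<sigma>\<subseteq>J j. p \<sigma> \<in> X \<and> (\<forall>i\<in>J j. (T ^^ i) (p \<sigma>) \<in> (if i \<in> \<sigma> then A else B))" for j
    using ind[of j] unfolding independent_times_def by metis
  then obtain p where p: "\<And>j \<sigma>. \<sigma> \<subseteq> J j \<Longrightarrow> p j \<sigma> \<in> X"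
    "\<And>j \<sigma> i. \<sigma> \<subseteq> J j \<Longrightarrow> i \<in> J j \<Longrightarrow> (T ^^ i) (p j \<sigma>) \<in> (if i \<in> \<sigma> then A else B)"
    by metis
  \<comment> \<open>Variable (0, t) is the letter at time t, constant for times outside J; variable (k, t) with
    k > 0 is the code of the orbit at time t and scale k - 1.\<close>
  define Y :: "nat \<Rightarrow> nat \<times> nat \<Rightarrow> nat set \<Rightarrow> nat" where
    "Y j = (\<lambda>(k, t) \<sigma>. if k = 0 then of_bool (t \<in> J j \<inter> \<sigma>) else q (k - 1) ((T ^^ t) (p j \<sigma>)))" for j
  define H where "H j = ent (Pow (J j)) (Y j)" for j
  \<comment> \<open>Averaging over \<open>N j\<close> translates makes \<open>G j\<close>
    shift-invariant up to an error of order \<open>1 / N j\<close>, as in the Krylov-Bogolyubov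
    construction.\<close>
  define G where "G j S = (\<Sum>i<N j. H j (shift i S)) / real (N j)" for j S
  \<comment> \<open>Alphabet sizes. They do not depend on the time, so the bound \<open>C\<close> is
    shift-invariant.\<close>
  define R :: "nat \<times> nat \<Rightarrow> nat" where "R s = (if fst s = 0 then 2 else r (fst s - 1))" for s
  define C where "C S = (\<Sum>s\<in>S. real (R s))" for S
  have Npos: "real (N j) > 0" for j using N[of j] by simp
  have H_nonneg: "0 \<le> H j S" for j S unfolding H_def using finJ by (intro ent_nonneg) auto
  have H_mono: "H j S \<le> H j S'" if "S \<subseteq> S'" for j S S'
    unfolding H_def using finJ that by (intro ent_mono) auto
  have C_shift: "C (shift i S) = C S" for i S
    unfolding C_def shift_def by (subst sum.reindex[OF inj_on_shift]) (auto simp: R_def intro!: sum.cong)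
  have H_le: "H j S \<le> C S" if "finite S" for j S
    unfolding H_def C_def
  proof (rule ent_le_sum)
    fix s assume "s \<in> S"
    have "Y j s ` Pow (J j) \<subseteq> {..<R s}"
      using p(1) T q by (auto simp: Y_def R_def split: prod.splits)
    then show "card (Y j s ` Pow (J j)) \<le> R s"
      using card_mono[of "{..<R s}"] by simp
  qed (use that finJ in auto)
  have G_nonneg: "0 \<le> G j S" for j S
    unfolding G_def by (intro divide_nonneg_nonneg sum_nonneg H_nonneg) simp
  have G_le: "G j S \<le> C S" if "finite S" for j S
  proof -
    have "(\<Sum>i<N j. H j (shift i S)) \<le> (\<Sum>i<N j. C S)"
      using H_le[of "shift i S" for i] that by (intro sum_mono) (simp add: C_shift)
    then show ?thesis using Npos[of j] by (simp add: G_def divide_le_eq mult.commute)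
  qed
  obtain f E where f: "strict_mono (f :: nat \<Rightarrow> nat)"
    and E: "\<And>S. finite S \<Longrightarrow> (\<lambda>j. G (f j) S) \<longlonglongrightarrow> E S"
    using bounded_family_convergent_subseq[of G C] G_nonneg G_le by (metis abs_of_nonneg)
  have G_shift: "\<bar>G j (shift 1 S) - G j S\<bar> \<le> C S * (1 / real (Suc j))" if S: "finite S" for j S
  proof -
    have "(\<Sum>i<N j. H j (shift i (shift 1 S))) - (\<Sum>i<N j. H j (shift i S))
       = (\<Sum>i<N j. H j (shift (Suc i) S) - H j (shift i S))"
      by (simp add: shift_shift sum_subtractf)
    also have "\<dots> = H j (shift (N j) S) - H j (shift 0 S)"
      by (rule sum_lessThan_telescope)
    finally have eq: "G j (shift 1 S) - G j S = (H j (shift (N j) S) - H j S) / real (N j)"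
      by (simp add: G_def diff_divide_distrib[symmetric])
    have "\<bar>H j (shift (N j) S) - H j S\<bar> \<le> C S"
      using H_le[of S j] H_le[of "shift (N j) S" j] S H_nonneg[of j S] H_nonneg[of j "shift (N j) S"]
      by (simp add: C_shift)
    then have "\<bar>G j (shift 1 S) - G j S\<bar> \<le> C S / real (N j)"
      unfolding eq by (simp add: divide_right_mono)
    also have "\<dots> \<le> C S / real (Suc j)"
      using N[of j] by (intro divide_left_mono) (auto simp: C_def sum_nonneg)
    finally show ?thesis by simp
  qed
  interpret shift_submodular E
  proof
    show "E {} = 0"
      using LIMSEQ_unique[OF E[of "{}"], of 0] by (simp add: G_def H_def shift_def ent_empty)
    show "E S \<le> E S'" if "finite S'" "S \<subseteq> S'" for S S'
    proof -
      have "finite S" using that finite_subset by blast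
      moreover have "G j S \<le> G j S'" for j
        unfolding G_def using that by (intro divide_right_mono sum_mono H_mono shift_mono) auto
      ultimately show ?thesis using E that(1) by (intro LIMSEQ_le[OF E E]) auto
    qed
    show "E (S \<union> S') + E (S \<inter> S') \<le> E S + E S'" if "finite S" "finite S'" for S S'
    proof -
      have H: "H j (shift i (S \<union> S')) + H j (shift i (S \<inter> S')) \<le> H j (shift i S) + H j (shift i S')" for j i
        unfolding H_def shift_Un shift_Int using finJ by (intro ent_submodular) auto
      have "G j (S \<union> S') + G j (S \<inter> S') \<le> G j S + G j S'" for j
        unfolding G_def add_divide_distrib[symmetric] sum.distrib[symmetric]
        by (intro divide_right_mono sum_mono H) auto
      then show ?thesis
        using that by (intro LIMSEQ_le[OF tendsto_add[OF E E] tendsto_add[OF E E]]) auto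
    qed
    show "E (shift 1 S) = E S" if S: "finite S" for S
    proof -
      have "(\<lambda>j. C S * (1 / real (Suc j))) \<longlonglongrightarrow> 0"
        using LIMSEQ_inverse_real_of_nat by (intro tendsto_mult_right_zero) (simp add: inverse_eq_divide)
      moreover have "\<forall>\<^sub>F j in sequentially. norm (G j (shift 1 S) - G j S) \<le> C S * (1 / real (Suc j))"
        unfolding real_norm_def by (intro always_eventually allI G_shift[OF S])
      ultimately have "(\<lambda>j. G j (shift 1 S) - G j S) \<longlonglongrightarrow> 0"
        by (rule Lim_null_comparison[rotated])
      from LIMSEQ_subseq_LIMSEQ[OF this f]
      have "(\<lambda>j. G (f j) (shift 1 S) - G (f j) S) \<longlonglongrightarrow> 0"
        by (simp add: o_def)
      moreover have "(\<lambda>j. G (f j) (shift 1 S) - G (f j) S) \<longlonglongrightarrow> E (shift 1 S) - E S"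
        using S by (intro tendsto_diff E) auto
      ultimately have "E (shift 1 S) - E S = 0" by (rule LIMSEQ_unique[rotated])
      then show ?thesis by simp
    qed
  qed
  \<comment> \<open>The letter at the present time.\<close>
  define P :: "(nat \<times> nat) set" where "P = {(0, 0)}"
  have finP: "finite P" by (simp add: P_def)
  have insert_shift: "shift i (P \<union> S) = insert (0, i) (shift i S)" for i S
    by (auto simp: shift_def P_def)
  \<comment> \<open>For \<open>i \<in> J j\<close> the letter at time \<open>i\<close> is a fair bit
    independent of the later letters and gains \<open>ln 2\<close>; such \<open>i\<close> have
    density at least \<delta> below \<open>N j\<close>.\<close>
  have base: "\<delta> * ln 2 \<le> cond P (block P {1..M})" for M
  proof -
    define D where "D = block P {1..M}"
    have finD: "finite D" using finP by (simp add: D_def)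
    have gain: "H j (shift i D) + (if i \<in> J j then ln 2 else 0) \<le> H j (shift i (P \<union> D))" for i j
    proof (cases "i \<in> J j")
      case True
      have row: "fst s = 0" if "s \<in> shift i (P \<union> D)" for s
        using that by (auto simp: shift_def block_def P_def D_def)
      have sub: "shift i D \<subseteq> shift i (P \<union> D)" by (intro shift_mono) auto
      have HJ: "H j S = card (J j \<inter> snd ` S) * ln 2" if "S \<subseteq> shift i (P \<union> D)" for S
        unfolding H_def
      proof (rule ent_Pow[OF finJ])
        fix s \<sigma> \<sigma>' assume "s \<in> S"
        then have "fst s = 0" using row that by blast
        then show "Y j s \<sigma> = Y j s \<sigma>' \<longleftrightarrow> (snd s \<in> J j \<inter> \<sigma> \<longleftrightarrow> snd s \<in> J j \<inter> \<sigma>')"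
          by (cases s) (auto simp: Y_def)
      qed
      have "i \<notin> snd ` shift i D" by (auto simp: shift_def block_def P_def D_def)
      then have "card (J j \<inter> snd ` shift i (P \<union> D)) = Suc (card (J j \<inter> snd ` shift i D))"
        unfolding insert_shift image_insert using True finJ[of j] by (simp add: Int_insert_right)
      then show ?thesis using True HJ[OF order_refl] HJ[OF sub] by (simp add: algebra_simps)
    next
      case False
      then show ?thesis by (simp add: H_mono shift_mono)
    qed
    have G: "G j D + \<delta> * ln 2 \<le> G j (P \<union> D)" for j
    proof -
      have "(\<Sum>i<N j. if i \<in> J j then ln 2 else 0) = real (card (J j)) * ln 2"
        using J[of j] by (simp add: sum.If_cases Int_absorb1)
      moreover have "(\<Sum>i<N j. H j (shift i D) + (if i \<in> J j then ln 2 else 0)) \<le> (\<Sum>i<N j. H j (shift i (P \<union> D)))"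
        by (intro sum_mono gain)
      ultimately have "(\<Sum>i<N j. H j (shift i D)) + real (card (J j)) * ln 2 \<le> (\<Sum>i<N j. H j (shift i (P \<union> D)))"
        unfolding sum.distrib by simp
      moreover have "\<delta> * ln 2 * real (N j) \<le> real (card (J j)) * ln 2"
        using mult_right_mono[OF dJ[of j], of "ln 2"] by (simp add: mult_ac)
      ultimately have "(\<Sum>i<N j. H j (shift i D)) + \<delta> * ln 2 * real (N j) \<le> (\<Sum>i<N j. H j (shift i (P \<union> D)))"
        by linarith
      from divide_right_mono[OF this, of "real (N j)"] show ?thesis
        using Npos[of j] by (simp add: G_def add_divide_distrib)
    qed
    have "E D + \<delta> * ln 2 \<le> E (P \<union> D)"
      using G finP finD by (intro LIMSEQ_le[OF tendsto_add[OF E tendsto_const] E]) auto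
    then show ?thesis by (simp add: cond_def D_def)
  qed
  \<comment> \<open>Invariant of the recursion: the present letter keeps positive entropy given all
    future copies of \<open>A\<close>, with a bound uniform in the horizon.\<close>
  define good where "good A \<longleftrightarrow> finite A \<and> P \<subseteq> A \<and> (\<exists>c>0. \<forall>M. c \<le> cond P (block A {1..M}))"
    for A
  have "good P"
    unfolding good_def using base d finP by (intro conjI exI[of _ "\<delta> * ln 2"]) auto
  \<comment> \<open>Row \<open>Suc k\<close>, the code at scale \<open>k\<close>, joins with a delay
    supplied by \<open>positive_cond_extend\<close>.\<close>
  have step: "\<exists>S'. good S' \<and> (\<exists>a. S' = S \<union> shift a {(Suc k, 0)})" if S: "good S" for S k
  proof -
    obtain c where c: "finite S" "P \<subseteq> S" "c > 0" "\<And>M. c \<le> cond P (block S {1..M})"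
      using S unfolding good_def by blast
    then obtain a where "\<forall>M. c / 2 \<le> cond P (block (S \<union> shift a {(Suc k, 0)}) {1..M})"
      using positive_cond_extend[OF c(1) _ c(2-4), of "{(Suc k, 0)}"] by auto
    then have "good (S \<union> shift a {(Suc k, 0)})"
      unfolding good_def using c(1-3)
      by (intro conjI exI[of _ "c / 2"]) auto
    then show ?thesis by blast
  qed
  have "\<exists>S. \<forall>k. good (S k) \<and> (\<exists>a. S (Suc k) = S k \<union> shift a {(Suc k, 0)})"
    by (rule dependent_nat_choice) (use \<open>good P\<close> step in blast)+
  then obtain S where S: "\<And>k. good (S k)" "\<And>k. \<exists>a. S (Suc k) = S k \<union> shift a {(Suc k, 0)}"
    by blast
  then obtain a where a: "\<And>k. S (Suc k) = S k \<union> shift (a k) {(Suc k, 0)}" by metis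
  have mem: "(Suc k, a k) \<in> S K" if "k < K" for k K
    using that
  proof (induction K)
    case (Suc K)
    then show ?case using a[of K] by (cases "k = K") (auto simp: shift_def)
  qed simp
  show thesis
  proof (rule that[of a])
    fix K
    \<comment> \<open>By \<open>mem\<close> this condition contains the code variables
      \<open>(Suc k, a k + t)\<close> for all \<open>k < K\<close> and
      \<open>1 \<le> t \<le> K\<close>.\<close>
    define D where "D = block (S K) {1..K}"
    have finD: "finite D" using S(1)[of K] by (simp add: good_def D_def)
    have "0 < cond P D" using S(1)[of K] unfolding good_def D_def by (meson less_le_trans)
    then have "0 < E (P \<union> D) - E D" by (simp add: cond_def)
    \<comment> \<open>Strict positivity of the limit descends to a finite stage \<open>j\<close>,
      then to one summand \<open>i\<close>, and finally to two itineraries \<sigma> and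
      \<tau>.\<close>
    moreover have "(\<lambda>j. G (f j) (P \<union> D) - G (f j) D) \<longlonglongrightarrow> E (P \<union> D) - E D"
      using finD finP by (intro tendsto_diff E) auto
    ultimately have "eventually (\<lambda>j. 0 < G (f j) (P \<union> D) - G (f j) D) sequentially"
      by (rule order_tendstoD(1)[rotated])
    then obtain j where "G j D < G j (P \<union> D)"
      by (auto simp: eventually_sequentially)
    then have "(\<Sum>i<N j. H j (shift i D)) < (\<Sum>i<N j. H j (shift i (P \<union> D)))"
      using Npos[of j] by (simp add: G_def divide_less_cancel)
    then obtain i where "H j (shift i D) < H j (shift i (P \<union> D))"
      by (meson not_le sum_mono)
    then have "ent (Pow (J j)) (Y j) (shift i D) < ent (Pow (J j)) (Y j) (insert (0, i) (shift i D))"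
      by (simp only: H_def insert_shift)
    then obtain \<sigma> \<tau> where st: "\<sigma> \<in> Pow (J j)" "\<tau> \<in> Pow (J j)"
      and agree: "\<And>s. s \<in> shift i D \<Longrightarrow> Y j s \<sigma> = Y j s \<tau>" and diff: "Y j (0, i) \<sigma> \<noteq> Y j (0, i) \<tau>"
      using ent_less_insertD[of "Pow (J j)"] finJ[of j] by (metis finite_Pow_iff)
    have codes: "q k ((T ^^ (a k + t)) ((T ^^ i) (p j \<sigma>))) = q k ((T ^^ (a k + t)) ((T ^^ i) (p j \<tau>)))"
      if "k < K" "t \<in> {1..K}" for k t
    proof -
      have "(Suc k, a k + t) \<in> D"
        using mem[OF that(1)] that(2) unfolding D_def block_def shift_def by force
      then have "(Suc k, a k + t + i) \<in> shift i D" unfolding shift_def by force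
      from agree[OF this] show ?thesis by (simp add: Y_def funpow_add)
    qed
    \<comment> \<open>Letters outside \<open>J j\<close> are constant, so differing letters force
      \<open>i \<in> J j\<close>; one of the two orbits is then in \<open>A\<close> and the other in
      \<open>B\<close> at time \<open>i\<close>.\<close>
    have i: "i \<in> J j" "i \<in> \<sigma> \<longleftrightarrow> i \<notin> \<tau>"
      using diff by (auto simp: Y_def of_bool_eq_iff)
    have X: "(T ^^ i) (p j \<sigma>) \<in> X" "(T ^^ i) (p j \<tau>) \<in> X" using T p(1) st by auto
    show "\<exists>u\<in>X \<inter> A. \<exists>v\<in>X \<inter> B. \<forall>k<K. \<forall>t\<in>{1..K}. q k ((T ^^ (a k + t)) u) = q k ((T ^^ (a k + t)) v)"
    proof (cases "i \<in> \<sigma>")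
      case True
      then have "(T ^^ i) (p j \<sigma>) \<in> X \<inter> A" "(T ^^ i) (p j \<tau>) \<in> X \<inter> B"
        using i p(2)[of \<sigma> j i] p(2)[of \<tau> j i] st X by auto
      then show ?thesis using codes by blast
    next
      case False
      then have "(T ^^ i) (p j \<tau>) \<in> X \<inter> A" "(T ^^ i) (p j \<sigma>) \<in> X \<inter> B"
        using i p(2)[of \<sigma> j i] p(2)[of \<tau> j i] st X by auto
      then show ?thesis using codes by (metis (no_types, lifting))
    qed
  qed
qed

text \<open>For fixed \<open>k\<close> and \<open>t\<close>, the codes at time
  \<open>a k + t\<close> agree for all large \<open>K\<close>. By continuity the resulting closeness
  passes to a limit point, which stays in the closed sets \<open>A\<close> and
  \<open>B\<close>.\<close>

lemma asymptotic_pair_of_independence: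
  fixes X :: "'a::metric_space set"
  assumes X: "compact X" and cont: "continuous_on X T" and TX: "T ` X \<subseteq> X"
    and AB: "closed A" "closed B" and d: "\<delta> > 0"
    and indep: "\<And>m. \<exists>n\<ge>m. \<exists>J\<subseteq>{..<n}. \<delta> * real n \<le> real (card J) \<and> independent_times T A B X J"
  shows "\<exists>u\<in>A. \<exists>v\<in>B. (u, v) \<in> asymptotic_pairs X T"
proof -
  have T: "(T ^^ i) x \<in> X" if "x \<in> X" for i x
    using that TX by (induction i) auto
  have contT: "continuous_on X (T ^^ i)" for i
  proof (induction i)
    case (Suc i)
    have "continuous_on ((T ^^ i) ` X) T"
      using T by (intro continuous_on_subset[OF cont]) auto
    then show ?case using continuous_on_compose[OF Suc] by (simp add: o_def)
  qed simp
  have "\<exists>q :: 'a \<Rightarrow> nat. \<exists>r. (\<forall>x\<in>X. q x < r) \<and>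
    (\<forall>x\<in>X. \<forall>y\<in>X. q x = q y \<longrightarrow> dist x y < 1 / real (Suc k))" for k
    using compact_finite_coding[OF X, of "1 / real (Suc k)"] by (metis of_nat_0_less_iff zero_less_Suc zero_less_divide_1_iff)
  then obtain q :: "nat \<Rightarrow> 'a \<Rightarrow> nat" and r where q: "\<And>k x. x \<in> X \<Longrightarrow> q k x < r k"
    and near: "\<And>k x y. x \<in> X \<Longrightarrow> y \<in> X \<Longrightarrow> q k x = q k y \<Longrightarrow> dist x y < 1 / real (Suc k)"
    by metis
  obtain a where "\<And>K. \<exists>u\<in>X \<inter> A. \<exists>v\<in>X \<inter> B. \<forall>k<K. \<forall>t\<in>{1..K}.
      q k ((T ^^ (a k + t)) u) = q k ((T ^^ (a k + t)) v)"
    using eventually_agreeing_codes[where X = X and T = T and A = A and B = B and q = q and r = r,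
        OF T d indep q] by blast
  then obtain u v where uv: "\<And>K. u K \<in> X \<inter> A" "\<And>K. v K \<in> X \<inter> B"
    and agree: "\<And>K k t. k < K \<Longrightarrow> t \<in> {1..K} \<Longrightarrow> q k ((T ^^ (a k + t)) (u K)) = q k ((T ^^ (a k + t)) (v K))"
    by metis
  have "compact ((X \<inter> A) \<times> (X \<inter> B))"
    using X AB by (intro compact_Times compact_Int_closed) auto
  then have "seq_compact ((X \<inter> A) \<times> (X \<inter> B))" by (simp add: compact_eq_seq_compact_metric)
  then obtain l s where l: "l \<in> (X \<inter> A) \<times> (X \<inter> B)" and s: "strict_mono (s :: nat \<Rightarrow> nat)"
    and lim: "((\<lambda>K. (u K, v K)) \<circ> s) \<longlonglongrightarrow> l"
    using seq_compactE[of _ "\<lambda>K. (u K, v K)"] uv by (metis (no_types, lifting) SigmaI)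
  obtain x y where xy: "l = (x, y)" by (cases l)
  have x: "x \<in> X" "x \<in> A" "(\<lambda>K. u (s K)) \<longlonglongrightarrow> x" and y: "y \<in> X" "y \<in> B" "(\<lambda>K. v (s K)) \<longlonglongrightarrow> y"
    using l tendsto_fst[OF lim] tendsto_snd[OF lim] by (auto simp: xy o_def)
  have close: "dist ((T ^^ (a k + t)) x) ((T ^^ (a k + t)) y) \<le> 1 / real (Suc k)" if t: "t \<ge> 1" for k t
  proof (rule LIMSEQ_le_const2)
    show "(\<lambda>K. dist ((T ^^ (a k + t)) (u (s K))) ((T ^^ (a k + t)) (v (s K))))
      \<longlonglongrightarrow> dist ((T ^^ (a k + t)) x) ((T ^^ (a k + t)) y)"
      using x y uv by (intro tendsto_dist continuous_on_tendsto_compose[OF contT]) auto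
    show "\<exists>M. \<forall>K\<ge>M. dist ((T ^^ (a k + t)) (u (s K))) ((T ^^ (a k + t)) (v (s K))) \<le> 1 / real (Suc k)"
    \<comment> \<open>This index guarantees both \<open>k < s K\<close> and
      \<open>t \<le> s K\<close>, the range in which the codes agree.\<close>
    proof (intro exI[of _ "Suc (k + t)"] allI impI)
      fix K assume "Suc (k + t) \<le> K"
      then have "Suc (k + t) \<le> s K" using seq_suble[OF s, of K] by linarith
      then have "q k ((T ^^ (a k + t)) (u (s K))) = q k ((T ^^ (a k + t)) (v (s K)))"
        using t by (intro agree) auto
      then show "dist ((T ^^ (a k + t)) (u (s K))) ((T ^^ (a k + t)) (v (s K))) \<le> 1 / real (Suc k)"
        using uv T by (intro less_imp_le near) auto
    qed
  qed
  have "(\<lambda>n. dist ((T ^^ n) x) ((T ^^ n) y)) \<longlonglongrightarrow> 0"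
  proof (rule LIMSEQ_I)
    fix e :: real assume "e > 0"
    then obtain k where k: "1 / real (Suc k) < e" using nat_approx_posE by blast
    have "dist ((T ^^ n) x) ((T ^^ n) y) < e" if "n \<ge> Suc (a k)" for n
    proof -
      \<comment> \<open>Agreement starts at offset 1, hence the threshold
        \<open>Suc (a k)\<close>.\<close>
      have "n = a k + (n - a k)" "n - a k \<ge> 1" using that by auto
      then show ?thesis using close[of "n - a k" k] k by simp
    qed
    then show "\<exists>m. \<forall>n\<ge>m. norm (dist ((T ^^ n) x) ((T ^^ n) y) - 0) < e" by auto
  qed
  then show ?thesis using x y by (auto simp: asymptotic_pairs_def)
qed

theorem proposition4:
  fixes X :: "'a::metric_space set" and T :: "'a \<Rightarrow> 'a"
  assumes "topological_dynamical_system X T"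
  shows "entropy_pairs X T \<subseteq> (top_of_set (X \<times> X)) closure_of (asymptotic_pairs X T)"
proof clarify
  fix x y assume xy: "(x, y) \<in> entropy_pairs X T"
  then have x: "x \<in> X" and y: "y \<in> X" and ne: "x \<noteq> y" by (auto simp: entropy_pairs_def)
  have X: "compact X" and cont: "continuous_on X T" and TX: "T ` X \<subseteq> X"
    using assms by (auto simp: topological_dynamical_system_def homeomorphism_def)
  have T: "(T ^^ i) z \<in> X" if "z \<in> X" for i z
    using that TX by (induction i) auto
  have key: "\<exists>u v. (u, v) \<in> asymptotic_pairs X T \<and> dist x u \<le> e \<and> dist y v \<le> e" if e: "e > 0" for e
  proof -
    \<comment> \<open>A third of the distance keeps the closed balls disjoint; the minimum with
      \<open>e\<close> keeps the pair found close to \<open>(x, y)\<close>.\<close>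
    define \<rho> where "\<rho> = min e (dist x y / 3)"
    have rho: "\<rho> > 0" "\<rho> \<le> e" "\<rho> \<le> dist x y / 3" using e ne by (auto simp: \<rho>_def)
    define A where "A = X \<inter> cball x \<rho>"
    define B where "B = X \<inter> cball y \<rho>"
    have closed: "closed A" "closed B"
      using X by (auto simp: A_def B_def intro!: closed_Int compact_imp_closed)
    have AB: "A \<inter> B = {}"
    proof (rule ccontr)
      assume "A \<inter> B \<noteq> {}"
      then obtain z where "dist x z \<le> \<rho>" "dist y z \<le> \<rho>" by (auto simp: A_def B_def)
      then have "dist x y \<le> 2 * \<rho>" using dist_triangle2[of x y z] by simp
      moreover have "dist x y > 0" using ne by simp
      ultimately show False using rho by simp
    qed
    have "openin (top_of_set X) (X - A)" "openin (top_of_set X) (X - B)"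
      using closed by (auto intro!: openin_diff simp: closedin_closed_Int closedin_subtopology_refl
        closed_subset A_def B_def)
    then have cover: "open_cover X {X - A, X - B}"
      using AB by (auto simp: open_cover_def)
    \<comment> \<open>The open ball of radius \<rho> witnesses that \<open>z\<close> is interior to
      the closed ball; in \<open>not_dense\<close> it is the neighbourhood that misses the cover
      element.\<close>
    have inner: "z \<in> (top_of_set X) interior_of (X - (X - X \<inter> cball z \<rho>))" if "z \<in> X" for z
      unfolding interior_of_def
    proof (intro CollectI exI[of _ "X \<inter> ball z \<rho>"] conjI)
      show "openin (top_of_set X) (X \<inter> ball z \<rho>)" by (simp add: openin_open_Int)
    qed (use that rho in auto)
    have not_dense: "(top_of_set X) closure_of (X - X \<inter> cball z \<rho>) \<noteq> X" if z: "z \<in> X" for z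
    proof
      assume "(top_of_set X) closure_of (X - X \<inter> cball z \<rho>) = X"
      then have "z \<in> (top_of_set X) closure_of (X - X \<inter> cball z \<rho>)" using z by simp
      moreover have "openin (top_of_set X) (X \<inter> ball z \<rho>)" by (simp add: openin_open_Int)
      moreover have "z \<in> X \<inter> ball z \<rho>" using z rho by simp
      ultimately obtain w where "w \<in> X - X \<inter> cball z \<rho>" "w \<in> X \<inter> ball z \<rho>"
        unfolding in_closure_of by blast
      then show False by auto
    qed
    have "cover_entropy X T {X - A, X - B} > 0"
      using xy cover inner[OF x] inner[OF y] not_dense[OF x] not_dense[OF y]
      unfolding entropy_pairs_def A_def B_def by blast
    then obtain \<delta> where "\<delta> > 0"
      "\<And>m. \<exists>n\<ge>m. \<exists>J\<subseteq>{..<n}. \<delta> * real n \<le> real (card J) \<and> independent_times T A B X J"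
      using positive_entropy_imp_independence[OF T AB] by blast
    then obtain u v where "u \<in> A" "v \<in> B" "(u, v) \<in> asymptotic_pairs X T"
      using asymptotic_pair_of_independence[OF X cont TX closed] by blast
    moreover from this have "dist x u \<le> e" "dist y v \<le> e"
      using rho by (auto simp: A_def B_def)
    ultimately show ?thesis by blast
  qed
  have "(x, y) \<in> closure (asymptotic_pairs X T)"
    unfolding closure_approachable
  proof (intro allI impI)
    fix e :: real assume e: "e > 0"
    then obtain u v where uv: "(u, v) \<in> asymptotic_pairs X T" "dist x u \<le> e / 4" "dist y v \<le> e / 4"
      using key[of "e / 4"] by auto
    have "dist (u, v) (x, y) \<le> dist u x + dist v y"
      unfolding dist_Pair_Pair by (rule sqrt_sum_squares_le_sum) auto
    then show "\<exists>w\<in>asymptotic_pairs X T. dist w (x, y) < e"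
      using uv e by (intro bexI[of _ "(u, v)"]) (auto simp: dist_commute)
  qed
  moreover have "asymptotic_pairs X T \<subseteq> X \<times> X" by (auto simp: asymptotic_pairs_def)
  ultimately show "(x, y) \<in> (top_of_set (X \<times> X)) closure_of (asymptotic_pairs X T)"
    using x y by (simp add: closure_of_subtopology Int_absorb1)
qed

end
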